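(* Let $w$ be a finite prime of $F$, $K$ the completion at $w$, $\phi$ a rank $r$ Drinfeld $A$-module over $K$ with stable reduction of rank $r'$, $1\le r'<r$, with Tate uniformization $(\psi,\Lambda,e_\phi)$, and let $\{\omega_i^0\}_{i=r'+1,\ldots,r}$ be an SMB of $\Lambda$. Let $u$ be a finite prime of $A$ and $n$ a positive integer with $|u^n|_\infty>|\omega_r^0|/|\omega_{r'+1}^0|$, and let $\{\lambda_i\}_{i=1,\ldots,r}$ be an SMB of $\phi[u^n]$. Then for each $i$ there is a unique $\omega_i'\in\mathbb{C}_w$ with $|\omega_i'|<|\omega_{r'+1}^0|$ and $e_\phi(\omega_i')=\lambda_i$, and: (1) $\{\omega_i'\}_{i=1,\ldots,r'}$ is an SMB of $\psi[u^n]$; (2) $\{u^n\cdot_\psi\omega_i'\}_{i=r'+1,\ldots,r}$ is an SMB of $\Lambda$.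
   Context: $q$ a power of a prime $p$, $A=\mathbb{F}_q[t]$, $F$ a finite extension of $\mathbb{F}_q(t)$; a finite prime of $F$ does not lie over $1/t$. $K$ the completion at $w$, $w$ its normalized valuation extended to $K^{\mathrm{sep}}$ and $\mathbb{C}_w$. Rank $r$ Drinfeld module: $\phi_t(X)=tX+a_1X^q+\cdots+a_rX^{q^r}$, $a_r\ne0$; $a\cdot_\phi x=\phi_a(x)$. Stable reduction of rank $r'$: all $a_i$ integral, $a_{r'}$ a unit, $w(a_i)>0$ for $i>r'$; good reduction: $r'=r$. For a rank $s$ Drinfeld module $\rho$ and monic irreducible $u\in A$, $\rho[u^n]$ is the $A/u^n$-module of roots of $\rho_{u^n}(X)$, and an SMB of $\rho[u^n]$ is $\{\lambda_i\}_{i=1}^s\subset\rho[u^n]$ with, for each $i$, $\lambda_1,\dots,\lambda_i$ $A/u^n$-linearly independent and $w(\lambda_i)$ largest among $w(\lambda)$ for $\lambda\in\rho[u^n]$ with $\lambda_1,\dots,\lambda_{i-1},\lambda$ $A/u^n$-linearly independent. Tate uniformization: rank $r'$ Drinfeld module $\psi$ over $K$ with good reduction; Galois-stable $A$-lattice $\Lambda\subset\mathbb{C}_w$ of rank $r-r'$ under $a\cdot_\psi z=\psi_a(z)$, nonzero elements of negative valuation; $e_\phi(z)=z\prod_{\mu\in\Lambda\setminus\{0\}}(1-z/\mu)$ surjective with kernel $\Lambda$, $e_\phi(\psi_a(z))=\phi_a(e_\phi(z))$. $|x|=(-w(x))^{1/r'}$ if $w(x)<0$, $-(w(x))^{1/r'}$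 if $w(x)\ge0$, $|0|=-\infty$; $|a|_\infty=q^{\deg a}$ for $a\in A$. SMB of $\Lambda$: $\{\omega_i^0\}_{i=r'+1}^r\subset\Lambda$ with each initial segment $A$-linearly independent (via $\psi$) and $|\omega^0_i|$ minimal among $|\omega|$, $\omega\in\Lambda$, with $\omega^0_{r'+1},\dots,\omega^0_{i-1},\omega$ $A$-linearly independent. *)

theory Defs
  imports "HOL-Analysis.Analysis" "HOL-Computational_Algebra.Computational_Algebra"
begin

text \<open>
  Conventions. \<open>'k\<close> is the finite field with \<open>q = CARD('k)\<close> elements, so \<open>'k poly\<close> is
  \<open>A = F\<^sub>q[t]\<close> and \<open>'k poly fract\<close> is \<open>F\<^sub>q(t)\<close>. The type \<open>'c\<close> is the field \<open>C\<^sub>w\<close>; the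
  fields \<open>F\<close> and \<open>K\<close> are subfields of it, and \<open>\<iota>\<close> is the embedding of \<open>F\<^sub>q(t)\<close> into \<open>C\<^sub>w\<close>.
  Valuations are additive, with value \<open>\<infinity>\<close> exactly at \<open>0\<close>.
\<close>

definition is_subfield :: "'c::field set \<Rightarrow> bool" where
  "is_subfield S \<longleftrightarrow> 0 \<in> S \<and> 1 \<in> S \<and>
     (\<forall>x\<in>S. \<forall>y\<in>S. x + y \<in> S \<and> x * y \<in> S) \<and> (\<forall>x\<in>S. - x \<in> S \<and> inverse x \<in> S)"

definition is_field_hom :: "('a::field \<Rightarrow> 'b::field) \<Rightarrow> bool" where
  "is_field_hom h \<longleftrightarrow> h 1 = 1 \<and> (\<forall>x y. h (x + y) = h x + h y) \<and> (\<forall>x y. h (x * y) = h x * h y)"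

definition algebraic_over :: "'c::field set \<Rightarrow> 'c \<Rightarrow> bool" where
  "algebraic_over S x \<longleftrightarrow> (\<exists>p. p \<noteq> 0 \<and> (\<forall>i. coeff p i \<in> S) \<and> poly p x = 0)"

definition is_valuation :: "('c::field \<Rightarrow> ereal) \<Rightarrow> bool" where
  "is_valuation w \<longleftrightarrow>
     (\<forall>x. w x = \<infinity> \<longleftrightarrow> x = 0) \<and> (\<forall>x. w x \<noteq> -\<infinity>) \<and>
     (\<forall>x y. w (x * y) = w x + w y) \<and> (\<forall>x y. min (w x) (w y) \<le> w (x + y))"

definition val_complete :: "('c::field \<Rightarrow> ereal) \<Rightarrow> 'c set \<Rightarrow> bool" where
  "val_complete w S \<longleftrightarrow>
     (\<forall>X :: nat \<Rightarrow> 'c. range X \<subseteq> S \<longrightarrow>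
        (\<forall>B::real. \<exists>N. \<forall>m\<ge>N. \<forall>n\<ge>N. ereal B < w (X m - X n)) \<longrightarrow>
        (\<exists>L\<in>S. (\<lambda>n. w (X n - L)) \<longlonglongrightarrow> \<infinity>))"

definition val_dense :: "('c::field \<Rightarrow> ereal) \<Rightarrow> 'c set \<Rightarrow> 'c set \<Rightarrow> bool" where
  "val_dense w D S \<longleftrightarrow> D \<subseteq> S \<and> (\<forall>x\<in>S. \<forall>B::real. \<exists>y\<in>D. ereal B < w (x - y))"

text \<open>
  \<open>F\<close> is a finite extension of \<open>F\<^sub>q(t)\<close>, the restriction of \<open>w\<close> to \<open>F\<close> is the normalized
  valuation of a prime of \<open>F\<close> not over \<open>1/t\<close> (i.e. \<open>1/t\<close> is not in the maximal ideal of the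
  prime), \<open>K\<close> is the completion of \<open>F\<close> and \<open>'c\<close> is the completion of an algebraic closure of
  \<open>K\<close>. Completions are characterized up to unique isomorphism as complete valued extensions
  containing the given field densely.
\<close>

locale completed_function_field =
  fixes \<iota> :: "'k::{field,finite} poly fract \<Rightarrow> 'c::alg_closed_field"
    and w :: "'c \<Rightarrow> ereal"
    and F K :: "'c set"
  assumes embedding: "is_field_hom \<iota>"
    and F_subfield: "is_subfield F"
    and F_extension: "range \<iota> \<subseteq> F"
    and F_finite: "\<exists>B. finite B \<and> B \<subseteq> F \<and> (\<forall>x\<in>F. \<exists>c. x = (\<Sum>b\<in>B. \<iota> (c b) * b))"
    and valuation: "is_valuation w"
    and normalized: "w ` (F - {0}) = range (\<lambda>k::int. ereal (of_int k))"
    and finite_prime: "\<not> 0 < w (1 / \<iota> (to_fract [:0, 1:]))"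
    and K_subfield: "is_subfield K"
    and K_complete: "val_complete w K"
    and F_dense: "val_dense w F K"
    and C_complete: "val_complete w UNIV"
    and algebraic_dense: "val_dense w {x. algebraic_over K x} UNIV"

text \<open>
  The coefficient \<open>a\<^sub>i\<close> in \<open>\<rho>\<^sub>t(X) = t X + a\<^sub>1 X\<^sup>q + \<dots>\<close>, where a Drinfeld module \<open>\<rho>\<close>
  is given by the family of polynomials \<open>\<rho>\<^sub>a\<close>, \<open>a \<in> A\<close>.
\<close>

definition dm_coeff :: "('k::{field,finite} poly \<Rightarrow> 'c::field poly) \<Rightarrow> nat \<Rightarrow> 'c" where
  "dm_coeff \<rho> i = coeff (\<rho> [:0, 1:]) (CARD('k) ^ i)"

definition drinfeld_module ::
  "('k::{field,finite} poly fract \<Rightarrow> 'c::field) \<Rightarrow> 'c set \<Rightarrow> nat \<Rightarrow> ('k poly \<Rightarrow> 'c poly) \<Rightarrow> bool" where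
  "drinfeld_module \<iota> K s \<rho> \<longleftrightarrow>
     1 \<le> s \<and>
     (\<forall>a b. \<rho> (a + b) = \<rho> a + \<rho> b) \<and>
     (\<forall>a b. \<rho> (a * b) = pcompose (\<rho> a) (\<rho> b)) \<and>
     (\<forall>c. \<rho> [:c:] = [:0, \<iota> (to_fract [:c:]):]) \<and>
     \<rho> [:0, 1:] = (\<Sum>i\<le>s. monom (dm_coeff \<rho> i) (CARD('k) ^ i)) \<and>
     (\<forall>i\<le>s. dm_coeff \<rho> i \<in> K) \<and>
     dm_coeff \<rho> 0 = \<iota> (to_fract [:0, 1:]) \<and>
     dm_coeff \<rho> s \<noteq> 0"

abbreviation dm_act :: "('k::{field,finite} poly \<Rightarrow> 'c::field poly) \<Rightarrow> 'k poly \<Rightarrow> 'c \<Rightarrow> 'c" where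
  "dm_act \<rho> a x \<equiv> poly (\<rho> a) x"

definition stable_reduction ::
  "('c::field \<Rightarrow> ereal) \<Rightarrow> nat \<Rightarrow> nat \<Rightarrow> ('k::{field,finite} poly \<Rightarrow> 'c poly) \<Rightarrow> bool" where
  "stable_reduction w r r' \<rho> \<longleftrightarrow>
     r' \<le> r \<and> (\<forall>i\<in>{1..r}. 0 \<le> w (dm_coeff \<rho> i)) \<and>
     w (dm_coeff \<rho> r') = 0 \<and> (\<forall>i\<in>{r'<..r}. 0 < w (dm_coeff \<rho> i))"

definition good_reduction ::
  "('c::field \<Rightarrow> ereal) \<Rightarrow> nat \<Rightarrow> ('k::{field,finite} poly \<Rightarrow> 'c poly) \<Rightarrow> bool" where
  "good_reduction w s \<rho> \<longleftrightarrow> stable_reduction w s s \<rho>"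

definition torsion :: "('k::{field,finite} poly \<Rightarrow> 'c::field poly) \<Rightarrow> 'k poly \<Rightarrow> 'c set" where
  "torsion \<rho> a = {x. poly (\<rho> a) x = 0}"

definition A_independent ::
  "('k::{field,finite} poly \<Rightarrow> 'c::field poly) \<Rightarrow> nat set \<Rightarrow> (nat \<Rightarrow> 'c) \<Rightarrow> bool" where
  "A_independent \<rho> I x \<longleftrightarrow> (\<forall>c. (\<Sum>j\<in>I. dm_act \<rho> (c j) (x j)) = 0 \<longrightarrow> (\<forall>j\<in>I. c j = 0))"

text \<open>
  Linear independence over \<open>A/m\<close> of elements of \<open>\<rho>[m]\<close>: the scalars in \<open>A/m\<close> are
  represented by elements of \<open>A\<close>, whose class vanishes iff \<open>m\<close> divides them.
\<close>

definition A_mod_independent ::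
  "('k::{field,finite} poly \<Rightarrow> 'c::field poly) \<Rightarrow> 'k poly \<Rightarrow> nat set \<Rightarrow> (nat \<Rightarrow> 'c) \<Rightarrow> bool" where
  "A_mod_independent \<rho> m I x \<longleftrightarrow>
     (\<forall>c. (\<Sum>j\<in>I. dm_act \<rho> (c j) (x j)) = 0 \<longrightarrow> (\<forall>j\<in>I. m dvd c j))"

text \<open>
  Successive minimum bases. In both definitions \<open>x(i := y)\<close> restricted to the indices up to
  \<open>i\<close> is the family \<open>\<dots>, x\<^bsub>i-1\<^esub>, y\<close>.
\<close>

definition torsion_SMB ::
  "('c::field \<Rightarrow> ereal) \<Rightarrow> ('k::{field,finite} poly \<Rightarrow> 'c poly) \<Rightarrow> nat \<Rightarrow> 'k poly \<Rightarrow> (nat \<Rightarrow> 'c) \<Rightarrow> bool"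
  where
  "torsion_SMB w \<rho> s m x \<longleftrightarrow>
     (\<forall>i\<in>{1..s}. x i \<in> torsion \<rho> m \<and> A_mod_independent \<rho> m {1..i} x \<and>
        (\<forall>y\<in>torsion \<rho> m. A_mod_independent \<rho> m {1..i} (x(i := y)) \<longrightarrow> w y \<le> w (x i)))"

definition val_abs :: "('c::field \<Rightarrow> ereal) \<Rightarrow> nat \<Rightarrow> 'c \<Rightarrow> ereal" where
  "val_abs w r' x =
     (if x = 0 then -\<infinity>
      else if w x < 0 then ereal ((- real_of_ereal (w x)) powr (1 / real r'))
      else ereal (- (real_of_ereal (w x) powr (1 / real r'))))"

definition deg_abs :: "'k::{field,finite} poly \<Rightarrow> real" where
  "deg_abs a = (if a = 0 then 0 else real CARD('k) ^ degree a)"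

text \<open>The parameters \<open>r'\<close> and \<open>r\<close> give the index range \<open>r'+1, \<dots>, r\<close>.\<close>

definition lattice_SMB ::
  "('c::field \<Rightarrow> ereal) \<Rightarrow> ('k::{field,finite} poly \<Rightarrow> 'c poly) \<Rightarrow> 'c set \<Rightarrow> nat \<Rightarrow> nat \<Rightarrow>
   (nat \<Rightarrow> 'c) \<Rightarrow> bool" where
  "lattice_SMB w \<psi> \<Lambda> r' r x \<longleftrightarrow>
     (\<forall>i\<in>{r'+1..r}. x i \<in> \<Lambda> \<and> A_independent \<psi> {r'+1..i} x \<and>
        (\<forall>y\<in>\<Lambda>. A_independent \<psi> {r'+1..i} (x(i := y)) \<longrightarrow> val_abs w r' (x i) \<le> val_abs w r' y))"

text \<open>
  An \<open>A\<close>-lattice of rank \<open>d\<close>: a discrete submodule for the action through \<open>\<psi>\<close> (finitely many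
  elements in every ball) that is finitely generated and projective of rank \<open>d\<close>, i.e. free of
  rank \<open>d\<close>, as \<open>A\<close> is a principal ideal domain.
\<close>

definition A_lattice ::
  "('c::field \<Rightarrow> ereal) \<Rightarrow> ('k::{field,finite} poly \<Rightarrow> 'c poly) \<Rightarrow> nat \<Rightarrow> 'c set \<Rightarrow> bool" where
  "A_lattice w \<psi> d \<Lambda> \<longleftrightarrow>
     (\<exists>b. A_independent \<psi> {1..d} b \<and> \<Lambda> = range (\<lambda>c. \<Sum>j\<in>{1..d}. dm_act \<psi> (c j) (b j))) \<and>
     (\<forall>B::real. finite {x\<in>\<Lambda>. ereal B \<le> w x})"

text \<open>
  The Galois group of \<open>K\<close> acts on \<open>C\<^sub>w\<close> by continuous extension from \<open>K\<^sup>s\<^sup>e\<^sup>p\<close>, and is thereby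
  identified with the group of continuous automorphisms of \<open>C\<^sub>w\<close> over \<open>K\<close>. For an additive map
  it suffices to require continuity at \<open>0\<close>.
\<close>

definition galois_group :: "('c::field \<Rightarrow> ereal) \<Rightarrow> 'c set \<Rightarrow> ('c \<Rightarrow> 'c) set" where
  "galois_group w K =
     {\<sigma>. is_field_hom \<sigma> \<and> bij \<sigma> \<and> (\<forall>x\<in>K. \<sigma> x = x) \<and>
         (\<forall>B::real. \<exists>C::real. \<forall>x. ereal C < w x \<longrightarrow> ereal B < w (\<sigma> x))}"

definition is_lattice_exp :: "('c::field \<Rightarrow> ereal) \<Rightarrow> 'c set \<Rightarrow> ('c \<Rightarrow> 'c) \<Rightarrow> bool" where
  "is_lattice_exp w \<Lambda> e \<longleftrightarrow>
     (\<forall>z. ((\<lambda>S. w (e z - z * (\<Prod>\<mu>\<in>S. 1 - z / \<mu>))) \<longlongrightarrow> \<infinity>) (finite_subsets_at_top (\<Lambda> - {0})))"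

definition tate_uniformization ::
  "('k::{field,finite} poly fract \<Rightarrow> 'c::field) \<Rightarrow> ('c \<Rightarrow> ereal) \<Rightarrow> 'c set \<Rightarrow> nat \<Rightarrow> nat \<Rightarrow>
   ('k poly \<Rightarrow> 'c poly) \<Rightarrow> ('k poly \<Rightarrow> 'c poly) \<Rightarrow> 'c set \<Rightarrow> ('c \<Rightarrow> 'c) \<Rightarrow> bool" where
  "tate_uniformization \<iota> w K r r' \<phi> \<psi> \<Lambda> e \<longleftrightarrow>
     drinfeld_module \<iota> K r' \<psi> \<and> good_reduction w r' \<psi> \<and>
     A_lattice w \<psi> (r - r') \<Lambda> \<and>
     (\<forall>\<sigma>\<in>galois_group w K. \<sigma> ` \<Lambda> = \<Lambda>) \<and>
     (\<forall>\<mu>\<in>\<Lambda> - {0}. w \<mu> < 0) \<and>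
     is_lattice_exp w \<Lambda> e \<and> surj e \<and> {z. e z = 0} = \<Lambda> \<and>
     (\<forall>a z. e (dm_act \<psi> a z) = dm_act \<phi> a (e z))"

end

theory Submission
  imports Defs
begin

text \<open>
  Good reduction makes \<open>\<psi>\<^sub>a\<close> multiply negative valuations by \<open>q\<^bsup>r' deg a\<^esup>\<close>, while \<open>e\<close> preserves the
  valuation of every \<open>z\<close> smaller than all nonzero lattice elements and does not increase the
  valuation of a \<open>z\<close> that is reduced modulo \<open>\<Lambda>\<close>. Independence over \<open>A/u\<^sup>n\<close> of a family is
  independence over the field \<open>A/u\<close> of its \<open>u\<^bsup>n-1\<^esup>\<close>-multiples, so dimensions can be compared by
  counting. Together \<open>\<psi>[u\<^sup>n]\<close> and the \<open>u\<^sup>n\<close>-division points of \<open>\<omega>\<^sup>0\<^bsub>r'+1\<^esub>, \<dots>, \<omega>\<^sup>0\<^sub>i\<close>, which are small by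
  the hypothesis on \<open>u\<^sup>n\<close>, supply enough independent torsion points to force \<open>\<lambda>\<^sub>i\<close> to be small, and
  its reduced preimage is then \<open>\<omega>'\<^sub>i\<close>. A combination of lattice vectors with coefficients of degree
  below \<open>deg u\<close> that is divisible by \<open>u\<close> yields a strictly smaller vector; this makes successive
  minima independent modulo \<open>u\<close> and shows that the \<open>u\<^sup>n\<omega>'\<^sub>i\<close> are successive minima of \<open>\<Lambda>\<close>.
\<close>

section \<open>Polynomials over fields\<close>

lemma card_degree_less:
  "finite {p :: 'k::{field,finite} poly. p = 0 \<or> degree p < d} \<and>
   card {p :: 'k poly. p = 0 \<or> degree p < d} = CARD('k) ^ d"
proof (induction d)
  case (Suc d)
  let ?S = "\<lambda>d. {p :: 'k poly. p = 0 \<or> degree p < d}"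
  have "?S (Suc d) = (\<lambda>(a, p). pCons a p) ` (UNIV \<times> ?S d)"
  proof (intro equalityI subsetI)
    fix p assume "p \<in> ?S (Suc d)"
    then show "p \<in> (\<lambda>(a, p). pCons a p) ` (UNIV \<times> ?S d)"
      by (cases p) (auto simp: image_iff split: if_splits)
  next
    fix p assume "p \<in> (\<lambda>(a, p). pCons a p) ` (UNIV \<times> ?S d)"
    then show "p \<in> ?S (Suc d)"
      by (auto simp: degree_pCons_eq_if split: if_splits)
  qed
  moreover have "inj_on (\<lambda>(a, p :: 'k poly). pCons a p) X" for X
    by (auto simp: inj_on_def)
  ultimately show ?case
    using Suc by (auto simp: card_image card_cartesian_product)
qed simp

text \<open>Agreement of the coefficients at \<open>card G\<close> pushes the degree of the
  difference below \<open>card G\<close>, while it still has \<open>card G\<close> roots.\<close>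

lemma poly_eqI_roots:
  fixes p q :: "'c::field poly"
  assumes "finite G" and "\<And>g. g \<in> G \<Longrightarrow> poly p g = poly q g"
    and "degree p \<le> card G" and "degree q \<le> card G"
    and "coeff p (card G) = coeff q (card G)"
  shows "p = q"
proof (rule ccontr)
  assume "p \<noteq> q"
  then have nz: "p - q \<noteq> 0"
    by simp
  have "degree (p - q) \<le> card G"
    using assms by (intro degree_diff_le)
  then have "degree (p - q) < card G"
    using eq_zero_or_degree_less[of "p - q" "card G"] nz assms(5) by auto
  moreover have "card G \<le> card {x. poly (p - q) x = 0}"
    using assms poly_roots_finite[OF nz] by (intro card_mono) auto
  moreover have "card {x. poly (p - q) x = 0} \<le> degree (p - q)"
    using nz by (rule card_poly_roots_bound)
  ultimately show False
    by simp
qed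

lemma monic_linear_prod:
  fixes f :: "'c::field \<Rightarrow> 'c"
  assumes "finite G"
  shows "degree (\<Prod>g\<in>G. [:f g, 1:]) = card G" "coeff (\<Prod>g\<in>G. [:f g, 1:]) (card G) = 1"
proof -
  show *: "degree (\<Prod>g\<in>G. [:f g, 1:]) = card G"
    by (subst degree_prod_eq_sum_degree) auto
  have "lead_coeff (\<Prod>g\<in>G. [:f g, 1:]) = 1"
    by (subst lead_coeff_prod) auto
  then show "coeff (\<Prod>g\<in>G. [:f g, 1:]) (card G) = 1"
    using * by simp
qed

text \<open>For fixed \<open>y\<close>, both sides are polynomials in \<open>x\<close> with the same leading term \<open>x\<^bsup>card G\<^esup>\<close>
  that agree on \<open>G\<close>.\<close>

lemma subgroup_prod_additive:
  fixes G :: "'c::field set"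
  assumes fin: "finite G" and zero: "0 \<in> G"
    and add: "\<And>x y. x \<in> G \<Longrightarrow> y \<in> G \<Longrightarrow> x + y \<in> G"
    and minus: "\<And>x. x \<in> G \<Longrightarrow> - x \<in> G"
  shows "(\<Prod>g\<in>G. x + y - g) = (\<Prod>g\<in>G. x - g) + (\<Prod>g\<in>G. y - g)"
proof -
  define p where "p = (\<Prod>g\<in>G. [:- g, 1:])"
  define p' where "p' = (\<Prod>g\<in>G. [:y - g, 1:])"
  define c where "c = (\<Prod>g\<in>G. y - g)"
  have card: "0 < card G"
    using fin zero by (auto simp: card_gt_0_iff)
  have p: "poly p z = (\<Prod>g\<in>G. z - g)" for z
    by (simp add: p_def poly_prod)
  have p': "poly p' z = (\<Prod>g\<in>G. z + y - g)" for z
    by (simp add: p'_def poly_prod algebra_simps)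
  have "p' = p + [:c:]"
  proof (rule poly_eqI_roots[OF fin])
    fix h assume h: "h \<in> G"
    \<comment> \<open>Translation by \<open>h\<close> permutes \<open>G\<close>, so on
      \<open>G\<close> the shifted product is constant.\<close>
    have "bij_betw (\<lambda>g. g - h) G G"
      using add[OF _ minus[OF h]] add[OF _ h]
      by (intro bij_betwI[where g = "\<lambda>g. g + h"]) auto
    then have "(\<Prod>g\<in>G. y - (g - h)) = c"
      unfolding c_def by (rule prod.reindex_bij_betw[where g = "\<lambda>g. y - g"])
    then have "poly p' h = c"
      by (simp add: p' algebra_simps)
    moreover have "poly p h = 0"
      using h fin by (auto simp: p)
    ultimately show "poly p' h = poly (p + [:c:]) h"
      by simp
  next
    show "degree p' \<le> card G"
      by (simp add: p'_def monic_linear_prod fin)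
    show "degree (p + [:c:]) \<le> card G"
      by (rule degree_add_le) (simp_all add: p_def monic_linear_prod fin)
    \<comment> \<open>As \<open>card G\<close> is positive, the constant \<open>c\<close> does not
      touch this coefficient, and both products are monic.\<close>
    show "coeff p' (card G) = coeff (p + [:c:]) (card G)"
      using card unfolding p_def p'_def coeff_add monic_linear_prod(2)[OF fin]
      by (cases "card G") auto
  qed
  then have "poly p' x = poly p x + c"
    by simp
  then show ?thesis
    by (simp add: p p' c_def)
qed

text \<open>Over an algebraically closed field the polynomial splits. A root occurring twice in the
  multiset of roots would also be a root of the derivative, so the multiset is a set.\<close>

lemma card_roots_separable:
  fixes p :: "'c::alg_closed_field poly"
  assumes "p \<noteq> 0" and sep: "\<And>x. poly p x = 0 \<Longrightarrow> poly (pderiv p) x \<noteq> 0"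
  shows "card {x. poly p x = 0} = degree p"
proof -
  obtain A where A: "size A = degree p" "p = smult (lead_coeff p) (\<Prod>x\<in>#A. [:-x, 1:])"
    using alg_closed_imp_factorization[OF assms(1)] by blast
  have lc: "lead_coeff p \<noteq> 0"
    using assms(1) by simp
  have roots: "poly p x = 0 \<longleftrightarrow> x \<in># A" for x
    by (subst A(2)) (use lc in \<open>auto simp: poly_prod_mset prod_mset_zero_iff image_iff\<close>)
  have "count A x \<le> 1" for x
  proof (rule ccontr)
    assume "\<not> count A x \<le> 1"
    then have "x \<in># A" "x \<in># A - {#x#}"
      by (auto simp flip: count_greater_zero_iff)
    then obtain B where B: "A = {#x, x#} + B"
      by (metis add_mset_add_single insert_DiffM union_commute union_mset_add_mset_left)
    define s where "s = smult (lead_coeff p) (\<Prod>x\<in>#B. [:-x, 1:])"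
    have "p = [:-x, 1:] * ([:-x, 1:] * s)"
      using A(2) by (simp add: B s_def mult_ac)
    then have "poly (pderiv p) x = 0"
      by (simp only: pderiv_mult poly_add poly_mult) simp
    moreover have "poly p x = 0"
      using roots \<open>x \<in># A\<close> by simp
    ultimately show False
      using sep by simp
  qed
  then have "A = mset_set (set_mset A)"
    by (intro multiset_eqI) (auto simp: count_mset_set' not_in_iff intro!: le_antisym)
  then have "size A = card (set_mset A)"
    by (metis size_mset_set)
  then show ?thesis
    using A(1) roots by simp
qed

text \<open>Multiplication by \<open>x \<noteq> 0\<close> permutes the nonzero elements, hence fixes
  their product while scaling it by \<open>x^(q-1)\<close>.\<close>

lemma finite_field_power_card:
  fixes x :: "'k::{field,finite}"
  shows "x \<noteq> 0 \<Longrightarrow> x ^ (CARD('k) - 1) = 1" and "x ^ CARD('k) = x"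
proof -
  have *: "x ^ (CARD('k) - 1) = 1" if x: "x \<noteq> 0"
  proof -
    have "bij_betw ((*) x) (UNIV - {0}) (UNIV - {0})"
      using x by (intro bij_betwI[where g = "\<lambda>y. y / x"]) auto
    then have "(\<Prod>y\<in>UNIV - {0}. x * y) = \<Prod>(UNIV - {0})"
      by (rule prod.reindex_bij_betw)
    then have "x ^ card (UNIV - {0 :: 'k}) * \<Prod>(UNIV - {0}) = \<Prod>(UNIV - {0})"
      by (simp add: prod.distrib)
    moreover have "\<Prod>(UNIV - {0 :: 'k}) \<noteq> 0"
      by simp
    ultimately show ?thesis
      by (simp add: card_Diff_singleton)
  qed
  then show "x \<noteq> 0 \<Longrightarrow> x ^ (CARD('k) - 1) = 1" .
  show "x ^ CARD('k) = x"
    using * by (cases "x = 0") (metis power_0_left zero_less_card_finite neq0_conv,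
        metis One_nat_def Suc_pred mult.right_neutral power_Suc zero_less_card_finite)
qed

lemma two_le_card_field: "2 \<le> CARD('k::{field,finite})"
proof -
  have "card {0, 1 :: 'k} \<le> CARD('k)"
    by (rule card_mono) auto
  then show ?thesis
    by simp
qed

section \<open>Finite constant fields and the Frobenius map\<close>

locale constant_field =
  fixes h :: "'k::{field,finite} \<Rightarrow> 'c::field"
  assumes hom: "is_field_hom h"
begin

lemma h_add: "h (x + y) = h x + h y" and h_mult: "h (x * y) = h x * h y" and h_1 [simp]: "h 1 = 1"
  using hom by (auto simp: is_field_hom_def)

lemma h_0 [simp]: "h 0 = 0"
  using h_add[of 0 0] by (metis add_cancel_right_right add_0)

lemma h_minus: "h (- x) = - h x"
  using h_add[of x "- x"] by (simp add: eq_neg_iff_add_eq_0 add.commute)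

lemma h_eq_0_iff: "h x = 0 \<longleftrightarrow> x = 0"
  using h_mult[of x "inverse x"] by (cases "x = 0") auto

lemma inj_h: "inj h"
proof (rule injI)
  fix x y assume "h x = h y"
  then have "h (x + - y) = 0"
    unfolding h_add h_minus by simp
  then show "x = y"
    unfolding h_eq_0_iff by simp
qed

lemma h_power: "h (x ^ n) = h x ^ n"
  by (induction n) (auto simp: h_mult)

text \<open>Translation by 1 permutes the finite field, so summing \<open>h\<close> over it is
  unaffected by adding \<open>q\<close> copies of 1.\<close>

lemma of_nat_card_eq_0: "of_nat CARD('k) = (0 :: 'c)"
proof -
  have "bij_betw (\<lambda>x :: 'k. x + 1) UNIV UNIV"
    by (rule bij_betwI[where g = "\<lambda>x. x - 1"]) auto
  then have "(\<Sum>x\<in>UNIV. h (x + 1)) = (\<Sum>x\<in>UNIV. h x)"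
    by (rule sum.reindex_bij_betw)
  then show ?thesis
    by (simp add: h_add sum.distrib)
qed

text \<open>The image of \<open>h\<close> is a finite additive group whose group polynomial is \<open>X\<^sup>q - X\<close>.\<close>

lemma power_card_add: "(x + y :: 'c) ^ CARD('k) = x ^ CARD('k) + y ^ CARD('k)"
proof -
  have q: "2 \<le> CARD('k)"
    by (rule two_le_card_field)
  have card: "card (range h) = CARD('k)"
    using inj_h by (simp add: card_image)
  define p :: "'c poly" where "p = monom 1 CARD('k) - monom 1 1"
  have p: "p = (\<Prod>g\<in>range h. [:- g, 1:])"
  proof (rule poly_eqI_roots[of "range h"])
    fix g assume g: "g \<in> range h"
    then obtain a where a: "g = h a" by blast
    have "g ^ CARD('k) = g"
      by (simp add: a finite_field_power_card flip: h_power)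
    moreover have "(\<Prod>g'\<in>range h. g - g') = 0"
      using g by (intro prod_zero) auto
    ultimately show "poly p g = poly (\<Prod>g\<in>range h. [:- g, 1:]) g"
      by (simp add: p_def poly_monom poly_prod)
  next
    show "degree p \<le> card (range h)"
      unfolding p_def card using q by (intro degree_diff_le) (auto simp: degree_monom_eq)
    show "degree (\<Prod>g\<in>range h. [:- g, 1:]) \<le> card (range h)"
      by (simp add: monic_linear_prod)
    show "coeff p (card (range h)) = coeff (\<Prod>g\<in>range h. [:- g, 1:]) (card (range h))"
      using q by (subst monic_linear_prod) (auto simp: p_def card)
  qed simp
  have *: "z ^ CARD('k) - z = (\<Prod>g\<in>range h. z - g)" for z
  proof -
    have "poly p z = poly (\<Prod>g\<in>range h. [:- g, 1:]) z"
      using p by (rule arg_cong)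
    then show ?thesis
      by (simp add: poly_prod) (simp add: p_def poly_monom)
  qed
  \<comment> \<open>The group polynomial \<open>X^q - X\<close> is additive, and removing its linear
    part leaves additivity of \<open>X^q\<close>.\<close>
  have "(x + y) ^ CARD('k) - (x + y) = (x ^ CARD('k) - x) + (y ^ CARD('k) - y)"
    unfolding *
  proof (rule subgroup_prod_additive)
    show "0 \<in> range h"
      by (metis h_0 rangeI)
    show "x + y \<in> range h" if "x \<in> range h" "y \<in> range h" for x y
      using that by (auto simp flip: h_add)
    show "- x \<in> range h" if "x \<in> range h" for x
      using that by (auto simp flip: h_minus)
  qed simp
  then show ?thesis
    by simp
qed

lemma power_card_power_add: "(x + y :: 'c) ^ (CARD('k) ^ i) = x ^ (CARD('k) ^ i) + y ^ (CARD('k) ^ i)"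
proof (induction i)
  case (Suc i)
  show ?case
    unfolding power_Suc2 power_mult Suc power_card_add by (rule refl)
qed simp

end

section \<open>Valuations\<close>

locale valued_field =
  fixes w :: "'c::field \<Rightarrow> ereal"
  assumes is_val: "is_valuation w"
begin

lemma w_eq_infinity_iff [simp]: "w x = \<infinity> \<longleftrightarrow> x = 0"
  and w_neq_minf [simp]: "w x \<noteq> -\<infinity>"
  and w_mult: "w (x * y) = w x + w y"
  and w_add_ge: "min (w x) (w y) \<le> w (x + y)"
  using is_val unfolding is_valuation_def by blast+

lemma w_0 [simp]: "w 0 = \<infinity>"
  by simp

lemma w_less_infinity_iff [simp]: "w x < \<infinity> \<longleftrightarrow> x \<noteq> 0"
  by (simp add: less_top[symmetric])

lemma w_realE:
  assumes "x \<noteq> 0"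
  obtains v where "w x = ereal v"
  using assms w_eq_infinity_iff[of x] w_neq_minf[of x] by (cases "w x") auto

lemma w_negE:
  assumes "w x < 0"
  obtains v where "w x = ereal v" "v < 0" "x \<noteq> 0"
proof -
  have "x \<noteq> 0"
    using assms by auto
  then obtain v where "w x = ereal v"
    by (rule w_realE)
  then show ?thesis
    using that[of v] assms \<open>x \<noteq> 0\<close> by simp
qed

lemma w_1 [simp]: "w 1 = 0"
proof -
  obtain v where v: "w 1 = ereal v"
    by (rule w_realE[of 1]) simp_all
  then show ?thesis
    using w_mult[of 1 1] by simp
qed

lemma w_minus [simp]: "w (- x) = w x"
proof -
  obtain v where v: "w (- 1) = ereal v"
    by (rule w_realE[of "- 1"]) simp_all
  have "w (- 1) = 0"
    using w_mult[of "- 1" "- 1"] v by simp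
  then show ?thesis
    using w_mult[of "- 1" x] by simp
qed

lemma w_diff_commute: "w (x - y) = w (y - x)"
  using w_minus[of "x - y"] by simp

lemma w_diff_ge: "min (w x) (w y) \<le> w (x - y)"
  using w_add_ge[of x "- y"] by simp

lemma w_add_eq:
  assumes "w x < w y"
  shows "w (x + y) = w x" and "w (y + x) = w x"
proof -
  show *: "w (x + y) = w x"
  proof (rule antisym)
    show "w x \<le> w (x + y)"
      using w_add_ge[of x y] assms by (simp add: min_absorb1)
    show "w (x + y) \<le> w x"
      using w_diff_ge[of "x + y" y] assms by (auto simp: min_def split: if_splits)
  qed
  then show "w (y + x) = w x"
    by (simp add: add.commute)
qed

lemma w_sum_ge:
  assumes "\<And>i. i \<in> I \<Longrightarrow> B \<le> w (f i)"
  shows "B \<le> w (\<Sum>i\<in>I. f i)"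
  using assms
proof (induction I rule: infinite_finite_induct)
  case (insert i I)
  then have "B \<le> min (w (f i)) (w (\<Sum>i\<in>I. f i))"
    by simp
  also have "\<dots> \<le> w (f i + (\<Sum>i\<in>I. f i))"
    by (rule w_add_ge)
  finally show ?case
    using insert by simp
qed simp_all

text \<open>The condition \<open>B < \<infinity>\<close> covers the empty sum, whose valuation is
  infinite.\<close>

lemma w_sum_gt:
  assumes "\<And>i. i \<in> I \<Longrightarrow> B < w (f i)" and "B < \<infinity>"
  shows "B < w (\<Sum>i\<in>I. f i)"
  using assms
proof (induction I rule: infinite_finite_induct)
  case (insert i I)
  then have "B < min (w (f i)) (w (\<Sum>i\<in>I. f i))"
    by simp
  also have "\<dots> \<le> w (f i + (\<Sum>i\<in>I. f i))"
    by (rule w_add_ge)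
  finally show ?case
    using insert by simp
qed simp_all

lemma w_prod_le_0:
  assumes "\<And>i. i \<in> I \<Longrightarrow> w (f i) \<le> 0"
  shows "w (\<Prod>i\<in>I. f i) \<le> 0"
  using assms by (induction I rule: infinite_finite_induct) (auto simp: w_mult intro: add_nonpos_nonpos)

lemma w_prod_eq_0:
  assumes "\<And>i. i \<in> I \<Longrightarrow> w (f i) = 0"
  shows "w (\<Prod>i\<in>I. f i) = 0"
  using assms by (induction I rule: infinite_finite_induct) (auto simp: w_mult)

lemma w_power:
  assumes "x \<noteq> 0"
  shows "w (x ^ n) = ereal (real n) * w x"
proof -
  obtain v where v: "w x = ereal v"
    using assms by (rule w_realE)
  show ?thesis
    by (induction n) (simp_all add: w_mult v algebra_simps flip: zero_ereal_def)
qed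

lemma w_power_nonneg: "0 \<le> w x \<Longrightarrow> 0 \<le> w (x ^ n)"
  by (induction n) (auto simp: w_mult)

text \<open>The valuation of a root of unity has a positive multiple equal to
  \<open>w 1 = 0\<close>. This makes the nonzero constants units.\<close>

lemma w_eq_0_if_power_eq_1:
  assumes "x ^ n = 1" and "0 < n"
  shows "w x = 0"
proof -
  have "x \<noteq> 0"
    using assms by (auto simp: power_0_left)
  then obtain v where "w x = ereal v"
    by (rule w_realE)
  then show ?thesis
    using w_power[OF \<open>x \<noteq> 0\<close>, of n] assms by (simp add: zero_ereal_def)
qed

lemma w_divide:
  assumes "y \<noteq> 0"
  shows "w (x / y) = w x - w y"
proof -
  obtain v where v: "w y = ereal v"
    using assms by (rule w_realE)
  have "w x = w (x / y) + w y"
    using assms w_mult[of "x / y" y] by simp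
  then show ?thesis
    using v by (cases "w x"; cases "w (x / y)") auto
qed

text \<open>Roots are strictly monotone on nonnegative reals; the branch \<open>w x < 0\<close>
  takes positive values and the other one nonpositive values. Later arguments can therefore work
  with \<open>w\<close> alone.\<close>

lemma val_abs_less_iff:
  assumes "1 \<le> s"
  shows "val_abs w s x < val_abs w s y \<longleftrightarrow> w y < w x"
proof (cases "x = 0 \<or> y = 0")
  case True
  then show ?thesis
    by (auto simp: val_abs_def)
next
  case False
  then obtain a b where ab: "w x = ereal a" "w y = ereal b"
    by (metis w_realE)
  have *: "c powr (1 / real s) < d powr (1 / real s) \<longleftrightarrow> c < d" if "0 \<le> c" "0 \<le> d" for c d
    using assms that powr_less_mono2[of "1 / real s" c d] powr_mono2[of "1 / real s" d c]
    by (auto simp: not_less[symmetric])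
  have pos: "0 < c powr (1 / real s)" if "0 < c" for c
    using that by simp
  have neg: "- (c powr (1 / real s)) \<le> 0" for c
    by simp
  have "- (b powr (1 / real s)) \<le> (- a) powr (1 / real s)" "- (a powr (1 / real s)) \<le> (- b) powr (1 / real s)"
    by (rule order_trans[OF neg], simp)+
  moreover have "- (a powr (1 / real s)) < (- b) powr (1 / real s)" if "b < 0"
    using le_less_trans[OF neg pos[of "- b"]] that by simp
  ultimately show ?thesis
    using False ab *[of "- a" "- b"] *[of b a]
    unfolding val_abs_def by (auto simp: not_less)
qed

lemma val_abs_le_iff:
  assumes "1 \<le> s"
  shows "val_abs w s x \<le> val_abs w s y \<longleftrightarrow> w y \<le> w x"
  using val_abs_less_iff[OF assms, of y x] by (simp flip: not_less)

text \<open>Raising to the power \<open>s\<close> undoes the root in \<open>val_abs\<close>. The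
  resulting factor \<open>Q ^ s\<close> is the one by which the action stretches negative valuations
  when \<open>Q\<close> is the absolute value of the scalar.\<close>

lemma val_abs_ratio_less:
  assumes "1 \<le> s" and "w x < 0" and "w y < 0"
    and "val_abs w s x / val_abs w s y < ereal Q"
  shows "ereal (Q ^ s) * w y < w x"
proof -
  obtain a b where ab: "w x = ereal (- a)" "w y = ereal (- b)" "0 < a" "0 < b"
    using assms(2,3) by (cases "w x"; cases "w y") (auto, metis add.inverse_inverse neg_less_0_iff_less neg_0_less_iff_less)
  have nz: "x \<noteq> 0" "y \<noteq> 0"
    using ab by auto
  have root: "(c powr (1 / real s)) ^ s = c" if "0 < c" for c
    using that assms(1) by (simp add: powr_powr flip: powr_realpow)
  have "a powr (1 / real s) / b powr (1 / real s) < Q"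
    using assms(4) ab nz by (simp add: val_abs_def)
  then have "a powr (1 / real s) < Q * b powr (1 / real s)"
    using ab by (simp add: field_simps)
  then have "(a powr (1 / real s)) ^ s < (Q * b powr (1 / real s)) ^ s"
    using assms(1) by (intro power_strict_mono) auto
  then have "a < Q ^ s * b"
    using ab by (simp add: root power_mult_distrib)
  then show ?thesis
    using ab by simp
qed

end

section \<open>Drinfeld modules with good reduction\<close>

text \<open>The assumption \<open>t_integral\<close> carries the finiteness of the prime:
  \<open>t\<close> has no pole there.\<close>

locale good_drinfeld_module = valued_field w
  for \<iota> :: "'k::{field,finite} poly fract \<Rightarrow> 'c::alg_closed_field"
    and w :: "'c \<Rightarrow> ereal" +
  fixes K :: "'c set" and s :: nat and \<psi> :: "'k poly \<Rightarrow> 'c poly"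
  assumes hom: "is_field_hom \<iota>"
    and t_integral: "0 \<le> w (\<iota> (to_fract [:0, 1:]))"
    and module: "drinfeld_module \<iota> K s \<psi>"
    and good: "good_reduction w s \<psi>"
begin

lemma q_ge_2: "2 \<le> CARD('k)"
  by (rule two_le_card_field)

lemma q_power_gt_0 [simp]: "0 < CARD('k) ^ i"
  by (rule zero_less_power) (rule zero_less_card_finite)

lemma s_ge_1: "1 \<le> s"
  using module by (simp add: drinfeld_module_def)

lemma iota_add: "\<iota> (x + y) = \<iota> x + \<iota> y" and iota_mult: "\<iota> (x * y) = \<iota> x * \<iota> y" and iota_1: "\<iota> 1 = 1"
  using hom by (auto simp: is_field_hom_def)

lemma iota_0: "\<iota> 0 = 0"
  using iota_add[of 0 0] by (metis add_cancel_right_right add_0)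

lemma iota_eq_0_iff: "\<iota> x = 0 \<longleftrightarrow> x = 0"
  using iota_mult[of x "inverse x"] by (cases "x = 0") (auto simp: iota_0 iota_1)

sublocale const: constant_field "\<lambda>c :: 'k. \<iota> (to_fract [:c:])"
proof
  have "to_fract [:x * y :: 'k:] = to_fract [:x:] * to_fract [:y:]" for x y
    by (simp flip: to_fract_mult)
  moreover have "to_fract [:x + y :: 'k:] = to_fract [:x:] + to_fract [:y:]" for x y
    by (simp flip: to_fract_add)
  moreover have "to_fract [:1 :: 'k:] = 1"
    by (simp flip: one_pCons)
  ultimately show "is_field_hom (\<lambda>c :: 'k. \<iota> (to_fract [:c:]))"
    by (simp add: is_field_hom_def iota_add iota_mult iota_1)
qed

lemma w_const: "c \<noteq> 0 \<Longrightarrow> w (\<iota> (to_fract [:c:])) = 0"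
  using finite_field_power_card(1)[of c] q_ge_2
  by (intro w_eq_0_if_power_eq_1[of _ "CARD('k) - 1"]) (simp_all flip: const.h_power)

lemma w_const_nonneg: "0 \<le> w (\<iota> (to_fract [:c:]))"
  by (cases "c = 0") (simp_all add: w_const iota_0)

lemma psi_add: "\<psi> (a + b) = \<psi> a + \<psi> b"
  and psi_mult: "\<psi> (a * b) = pcompose (\<psi> a) (\<psi> b)"
  and psi_const: "\<psi> [:c:] = [:0, \<iota> (to_fract [:c:]):]"
  and psi_t: "\<psi> [:0, 1:] = (\<Sum>i\<le>s. monom (dm_coeff \<psi> i) (CARD('k) ^ i))"
  and coeff_0: "dm_coeff \<psi> 0 = \<iota> (to_fract [:0, 1:])"
  and coeff_s: "dm_coeff \<psi> s \<noteq> 0"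
  using module unfolding drinfeld_module_def by blast+

lemma psi_0: "\<psi> 0 = 0"
  using psi_const[of 0] by (simp add: iota_0)

text \<open>Horner's scheme: induction on \<open>a\<close> reduces questions about
  \<open>\<psi> a\<close> to the action of \<open>t\<close>.\<close>

lemma psi_pCons: "\<psi> (pCons c a) = [:0, \<iota> (to_fract [:c:]):] + pcompose (\<psi> [:0, 1:]) (\<psi> a)"
proof -
  have "pCons c a = [:c:] + [:0, 1:] * a"
    by simp
  then show ?thesis
    by (metis psi_add psi_mult psi_const)
qed

lemma act_t: "poly (\<psi> [:0, 1:]) x = (\<Sum>i\<le>s. dm_coeff \<psi> i * x ^ (CARD('k) ^ i))"
  by (simp add: psi_t poly_sum poly_monom)

lemma act_pCons: "poly (\<psi> (pCons c a)) x = \<iota> (to_fract [:c:]) * x + poly (\<psi> [:0, 1:]) (poly (\<psi> a) x)"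
  by (simp add: psi_pCons[of c a] poly_pcompose mult.commute)

lemma act_t_add: "poly (\<psi> [:0, 1:]) (x + y) = poly (\<psi> [:0, 1:]) x + poly (\<psi> [:0, 1:]) y"
  by (simp add: act_t const.power_card_power_add algebra_simps sum.distrib)

lemma act_add: "poly (\<psi> a) (x + y) = poly (\<psi> a) x + poly (\<psi> a) y"
proof (induction a)
  case (pCons c a)
  then show ?case
    by (simp add: act_pCons[of c a] act_t_add distrib_left)
qed (simp add: psi_0)

sublocale act: Modules.module "\<lambda>a. poly (\<psi> a)"
proof
  show "poly (\<psi> 1) x = x" for x
    by (simp add: one_pCons psi_const const.h_1)
qed (simp_all add: act_add psi_add psi_mult poly_pcompose)

lemma degree_psi_t: "degree (\<psi> [:0, 1:]) = CARD('k) ^ s"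
proof (rule antisym)
  show "degree (\<psi> [:0, 1:]) \<le> CARD('k) ^ s"
    unfolding psi_t
  proof (rule degree_sum_le)
    fix i assume "i \<in> {..s}"
    then have "CARD('k) ^ i \<le> CARD('k) ^ s"
      using q_ge_2 by (intro power_increasing) auto
    then show "degree (monom (dm_coeff \<psi> i) (CARD('k) ^ i)) \<le> CARD('k) ^ s"
      using degree_monom_le[of "dm_coeff \<psi> i" "CARD('k) ^ i"] by simp
  qed simp
  show "CARD('k) ^ s \<le> degree (\<psi> [:0, 1:])"
    using coeff_s unfolding dm_coeff_def by (rule le_degree)
qed

lemma degree_psi: "a \<noteq> 0 \<Longrightarrow> degree (\<psi> a) = CARD('k) ^ (s * degree a)"
proof (induction a)
  case (pCons c a)
  show ?case
  proof (cases "a = 0")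
    case True
    then show ?thesis
      using pCons.prems const.h_eq_0_iff[of c] by (simp add: psi_const)
  next
    case False
    have deg: "degree (pcompose (\<psi> [:0, 1:]) (\<psi> a)) = CARD('k) ^ (s * degree (pCons c a))"
      using False pCons.IH by (simp add: degree_pcompose degree_psi_t power_add)
    have "1 < CARD('k) ^ (s * degree (pCons c a))"
      using False s_ge_1 q_ge_2 by (intro one_less_power) auto
    then have "degree [:0, \<iota> (to_fract [:c:]):] < degree (pcompose (\<psi> [:0, 1:]) (\<psi> a))"
      unfolding deg by (auto intro: le_less_trans[of _ 1])
    then show ?thesis
      unfolding psi_pCons[of c a] using deg by (subst degree_add_eq_right) auto
  qed
qed simp

text \<open>The exponents \<open>q^i\<close> with \<open>i > 0\<close> vanish in the field, so only
  the linear term survives.\<close>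

lemma pderiv_psi_t: "pderiv (\<psi> [:0, 1:]) = [:\<iota> (to_fract [:0, 1:]):]"
proof -
  have "pderiv (\<Sum>i\<in>I. f i) = (\<Sum>i\<in>I. pderiv (f i))" for I :: "nat set" and f :: "nat \<Rightarrow> 'c poly"
    by (induction I rule: infinite_finite_induct) (simp_all add: pderiv_add)
  then have "pderiv (\<psi> [:0, 1:]) = (\<Sum>i\<le>s. monom (of_nat (CARD('k) ^ i) * dm_coeff \<psi> i) (CARD('k) ^ i - 1))"
    by (simp add: psi_t pderiv_monom)
  also have "\<dots> = (\<Sum>i\<le>s. if i = 0 then [:\<iota> (to_fract [:0, 1:]):] else 0)"
  proof (intro sum.cong refl)
    fix i
    show "monom (of_nat (CARD('k) ^ i) * dm_coeff \<psi> i) (CARD('k) ^ i - 1) =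
      (if i = 0 then [:\<iota> (to_fract [:0, 1:]):] else 0)"
      using const.of_nat_card_eq_0 by (cases "i = 0") (auto simp: coeff_0 monom_0)
  qed
  finally show ?thesis
    by simp
qed

lemma pderiv_psi: "pderiv (\<psi> a) = [:\<iota> (to_fract a):]"
proof (induction a)
  case (pCons c a)
  have "to_fract (pCons c a) = to_fract [:c:] + to_fract [:0, 1:] * to_fract a"
    by (simp flip: to_fract_add to_fract_mult)
  then show ?case
    by (simp add: psi_pCons[of c a] pderiv_add pderiv_pCons pderiv_pcompose pderiv_psi_t pCons iota_add iota_mult
        mult.commute)
qed (simp add: psi_0 iota_0)

text \<open>The derivative of \<open>\<psi> a\<close> is a nonzero constant, so all roots are simple
  and their number is the degree.\<close>

lemma card_torsion:
  assumes "a \<noteq> 0"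
  shows "finite (torsion \<psi> a)" "card (torsion \<psi> a) = CARD('k) ^ (s * degree a)"
proof -
  have nz: "\<psi> a \<noteq> 0"
    using degree_psi[OF assms] q_power_gt_0[of "s * degree a"] by (metis degree_0 less_irrefl)
  then show "finite (torsion \<psi> a)"
    unfolding torsion_def by (rule poly_roots_finite)
  show "card (torsion \<psi> a) = CARD('k) ^ (s * degree a)"
    unfolding torsion_def using assms nz
    by (subst card_roots_separable) (simp_all add: pderiv_psi iota_eq_0_iff degree_psi)
qed

lemma act_surj:
  assumes "a \<noteq> 0"
  obtains z where "poly (\<psi> a) z = y"
proof -
  have "0 < degree (\<psi> a)"
    by (simp add: degree_psi assms)
  then have "0 < degree (\<psi> a + [:- y:])"
    by (subst degree_add_eq_left) auto
  then obtain z where "poly (\<psi> a + [:- y:]) z = 0"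
    using alg_closed_imp_poly_has_root by blast
  then show ?thesis
    by (intro that[of z]) simp
qed

section \<open>Valuations under an action with good reduction\<close>

lemma coeff_integral: "i \<le> s \<Longrightarrow> 0 \<le> w (dm_coeff \<psi> i)" and coeff_unit: "w (dm_coeff \<psi> s) = 0"
proof -
  show "w (dm_coeff \<psi> s) = 0"
    using good by (simp add: good_reduction_def stable_reduction_def)
  show "0 \<le> w (dm_coeff \<psi> i)" if "i \<le> s"
  proof (cases "i = 0")
    case True
    then show ?thesis
      using t_integral by (simp add: coeff_0)
  next
    case False
    then show ?thesis
      using that good by (simp add: good_reduction_def stable_reduction_def)
  qed
qed

lemma w_act_t_nonneg: "0 \<le> w x \<Longrightarrow> 0 \<le> w (poly (\<psi> [:0, 1:]) x)"
  unfolding act_t by (rule w_sum_ge) (simp add: w_mult coeff_integral w_power_nonneg)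

text \<open>The leading coefficient is a unit and the others are integral, so for negative
  \<open>w x\<close> the term of highest degree strictly dominates.\<close>

lemma w_act_t_neg:
  assumes "w x < 0"
  shows "w (poly (\<psi> [:0, 1:]) x) = ereal (real (CARD('k) ^ s)) * w x"
proof -
  obtain v where v: "w x = ereal v" "x \<noteq> 0"
    using assms by (rule w_negE)
  then have wpow: "w (x ^ (CARD('k) ^ i)) = ereal (real (CARD('k) ^ i) * v)" for i
    by (simp add: w_power v)
  have lead: "w (dm_coeff \<psi> s * x ^ (CARD('k) ^ s)) = ereal (real (CARD('k) ^ s) * v)"
    by (simp only: w_mult wpow coeff_unit) simp
  have "ereal (real (CARD('k) ^ s) * v) < w (\<Sum>i<s. dm_coeff \<psi> i * x ^ (CARD('k) ^ i))"
  proof (rule w_sum_gt)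
    fix i assume i: "i \<in> {..<s}"
    then have "CARD('k) ^ i < CARD('k) ^ s"
      using q_ge_2 by (intro power_strict_increasing) auto
    then have "real (CARD('k) ^ i) < real (CARD('k) ^ s)"
      by (simp only: of_nat_less_iff)
    then have "real (CARD('k) ^ s) * v < real (CARD('k) ^ i) * v"
      using assms v by (intro mult_strict_right_mono_neg) simp_all
    then have "ereal (real (CARD('k) ^ s) * v) < w (x ^ (CARD('k) ^ i))"
      unfolding wpow by simp
    also have "\<dots> \<le> w (dm_coeff \<psi> i * x ^ (CARD('k) ^ i))"
      using coeff_integral[of i] i by (simp add: w_mult add_increasing)
    finally show "ereal (real (CARD('k) ^ s) * v) < w (dm_coeff \<psi> i * x ^ (CARD('k) ^ i))" .
  qed simp
  then have "w (dm_coeff \<psi> s * x ^ (CARD('k) ^ s) + (\<Sum>i<s. dm_coeff \<psi> i * x ^ (CARD('k) ^ i))) = ereal (real (CARD('k) ^ s) * v)"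
    using w_add_eq(1) lead by simp
  then show ?thesis
    by (simp add: act_t v lessThan_Suc_atMost[symmetric] add.commute)
qed

lemma w_act_nonneg: "0 \<le> w x \<Longrightarrow> 0 \<le> w (poly (\<psi> a) x)"
proof (induction a)
  case (pCons c a)
  then have "0 \<le> w (\<iota> (to_fract [:c:]) * x)"
    by (simp add: w_mult w_const_nonneg)
  moreover have "0 \<le> w (poly (\<psi> [:0, 1:]) (poly (\<psi> a) x))"
    using pCons by (intro w_act_t_nonneg)
  ultimately show ?case
    unfolding act_pCons[of c a] by (rule order_trans[OF min.boundedI w_add_ge])
qed simp

text \<open>Each factor \<open>t\<close> multiplies a negative valuation by \<open>q^s\<close>. The
  constant multiple of \<open>x\<close> added at each Horner step has valuation at least
  \<open>w x\<close> and cannot compete.\<close>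

lemma w_act_neg:
  assumes "w x < 0" and "a \<noteq> 0"
  shows "w (poly (\<psi> a) x) = ereal (real (CARD('k) ^ (s * degree a))) * w x"
  using assms(2)
proof (induction a)
  case (pCons c a)
  obtain v where v: "w x = ereal v" "v < 0"
    using assms(1) by (rule w_negE)
  show ?case
  proof (cases "a = 0")
    case True
    then show ?thesis
      using pCons.prems by (simp add: act_pCons[of c 0] w_mult w_const)
  next
    case False
    let ?d = "s * degree (pCons c a)"
    have "w (poly (\<psi> a) x) = ereal (real (CARD('k) ^ (s * degree a)) * v)"
      using pCons.IH False v by simp
    moreover have "real (CARD('k) ^ (s * degree a)) * v < 0"
      using v by (intro mult_pos_neg) auto
    ultimately have lead: "w (poly (\<psi> [:0, 1:]) (poly (\<psi> a) x)) = ereal (real (CARD('k) ^ ?d) * v)"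
      using False by (subst w_act_t_neg) (simp_all add: power_add)
    have "1 < CARD('k) ^ ?d"
      using False s_ge_1 q_ge_2 by (intro one_less_power) auto
    then have "1 < real (CARD('k) ^ ?d)"
      by (simp only: of_nat_1 flip: of_nat_less_iff[where ?'a = real])
    then have "real (CARD('k) ^ ?d) * v < 1 * v"
      using v by (intro mult_strict_right_mono_neg) simp_all
    then have "ereal (real (CARD('k) ^ ?d) * v) < w x"
      by (simp add: v)
    also have "\<dots> \<le> w (\<iota> (to_fract [:c:]) * x)"
      using w_const_nonneg by (simp add: w_mult add_increasing)
    finally have "w (poly (\<psi> (pCons c a)) x) = ereal (real (CARD('k) ^ ?d) * v)"
      unfolding act_pCons[of c a] using lead by (subst w_add_eq(2)) auto
    then show ?thesis
      by (simp add: v)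
  qed
qed simp

lemma w_act_less_0_iff: "a \<noteq> 0 \<Longrightarrow> w (poly (\<psi> a) x) < 0 \<longleftrightarrow> w x < 0"
proof (cases "w x < 0")
  case True
  then obtain v where v: "w x = ereal v" "v < 0"
    by (rule w_negE)
  moreover assume "a \<noteq> 0"
  ultimately have "w (poly (\<psi> a) x) = ereal (real (CARD('k) ^ (s * degree a)) * v)"
    using w_act_neg[OF True] by simp
  moreover have "real (CARD('k) ^ (s * degree a)) * v < 0"
    using v by (intro mult_pos_neg) auto
  ultimately show ?thesis
    using True by simp
next
  case False
  then show ?thesis
    using w_act_nonneg[of x a] by (simp add: leD)
qed

text \<open>A point of negative valuation keeps a negative valuation under \<open>a\<close>, so it
  is not killed. This separates torsion from the lattice, whose nonzero elements are not
  integral.\<close>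

lemma w_torsion:
  assumes "z \<in> torsion \<psi> a" and "a \<noteq> 0"
  shows "0 \<le> w z"
  using assms w_act_less_0_iff[of a z] by (auto simp: torsion_def not_less)

end

section \<open>Linear independence over the polynomial ring\<close>

text \<open>For \<open>u \<noteq> 0\<close> these are canonical representatives of
  \<open>A/u\<close>; the separate zero clause matters for constant \<open>u\<close>, where only
  \<open>0\<close> remains.\<close>

definition residues :: "'k::{field,finite} poly \<Rightarrow> 'k poly set" where
  "residues u = {p. p = 0 \<or> degree p < degree u}"

lemma finite_residues [simp]: "finite (residues (u :: 'k::{field,finite} poly))"
  and card_residues: "card (residues u) = CARD('k) ^ degree u"
  using card_degree_less[where ?'k = 'k, of "degree u"] unfolding residues_def by auto

lemma mod_in_residues: "u \<noteq> 0 \<Longrightarrow> p mod u \<in> residues u"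
  using degree_mod_less[of u p] by (auto simp: residues_def)

lemma residues_diff: "p \<in> residues u \<Longrightarrow> p' \<in> residues u \<Longrightarrow> p - p' \<in> residues u"
  by (auto simp: residues_def intro: le_less_trans[OF degree_diff_le_max])

lemma residues_dvd_imp_eq_0: "p \<in> residues u \<Longrightarrow> u dvd p \<Longrightarrow> p = 0"
  using dvd_imp_degree_le[of u p] by (cases "p = 0") (auto simp: residues_def)

lemma degree_gt_0_if_prime:
  fixes u :: "'k::field poly"
  assumes "prime_elem u"
  shows "0 < degree u"
  using assms by (auto simp: prime_elem_def is_unit_iff_degree)

text \<open>Multiplication by \<open>c\<close> is injective on the finite set of residues.\<close>

lemma inverse_mod_prime:
  fixes u c :: "'k::{field,finite} poly"
  assumes "prime_elem u" and "\<not> u dvd c"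
  obtains a where "u dvd a * c - 1"
proof -
  have u: "u \<noteq> 0"
    using assms by auto
  let ?f = "\<lambda>a. (a * c) mod u"
  have "inj_on ?f (residues u)"
  proof (rule inj_onI)
    fix a b assume ab: "a \<in> residues u" "b \<in> residues u" "?f a = ?f b"
    then have "u dvd (a - b) * c"
      by (simp add: mod_eq_dvd_iff algebra_simps)
    then have "u dvd a - b"
      using assms prime_elem_dvd_mult_iff by blast
    then show "a = b"
      using residues_dvd_imp_eq_0[OF residues_diff[OF ab(1,2)]] by simp
  qed
  moreover have "?f ` residues u \<subseteq> residues u"
    using mod_in_residues[OF u] by auto
  ultimately have "?f ` residues u = residues u"
    by (intro endo_inj_surj) simp_all
  moreover have one: "1 \<in> residues u"
    using degree_gt_0_if_prime[OF assms(1)] by (simp add: residues_def)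
  ultimately obtain a where a: "1 = ?f a"
    by blast
  have "1 mod u = 1"
    using one degree_gt_0_if_prime[OF assms(1)] by (simp add: mod_poly_less)
  then have "(a * c) mod u = 1 mod u"
    using a by simp
  then have "u dvd a * c - 1"
    by (simp only: mod_eq_dvd_iff)
  then show ?thesis
    by (rule that)
qed

text \<open>Only the module laws are assumed, so that the same linear algebra serves
  \<open>\<psi>\<close> and \<open>\<phi>\<close>.\<close>

locale polynomial_action = Modules.module "\<lambda>a. poly (\<rho> a)"
  for \<rho> :: "'k::{field,finite} poly \<Rightarrow> 'c::field poly"
begin

lemma act_zero_if_dvd:
  assumes "x \<in> torsion \<rho> u" and "u dvd c"
  shows "poly (\<rho> c) x = 0"
proof -
  obtain k where "c = k * u"
    using assms(2) by (metis dvdE mult.commute)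
  then have "poly (\<rho> c) x = poly (\<rho> k) (poly (\<rho> u) x)"
    by simp
  then show ?thesis
    using assms(1) by (simp add: torsion_def del: scale_scale)
qed

lemma act_mod:
  assumes "x \<in> torsion \<rho> u"
  shows "poly (\<rho> (c mod u)) x = poly (\<rho> c) x"
proof -
  have "poly (\<rho> (c - c mod u)) x = 0"
    by (rule act_zero_if_dvd[OF assms]) (rule dvd_minus_mod)
  then show ?thesis
    by (simp add: scale_left_diff_distrib)
qed

lemma torsion_mult:
  "x \<in> torsion \<rho> (u * a) \<Longrightarrow> poly (\<rho> a) x \<in> torsion \<rho> u"
  by (simp add: torsion_def)

definition combinations :: "nat set \<Rightarrow> (nat \<Rightarrow> 'c) \<Rightarrow> 'c set" where
  "combinations I x = range (\<lambda>c. \<Sum>j\<in>I. poly (\<rho> (c j)) (x j))"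

lemma combinations_act:
  assumes "y \<in> combinations I x"
  shows "poly (\<rho> a) y \<in> combinations I x"
proof -
  obtain c where c: "y = (\<Sum>j\<in>I. poly (\<rho> (c j)) (x j))"
    using assms by (auto simp: combinations_def)
  show ?thesis
    unfolding combinations_def
    by (rule image_eqI[of _ _ "\<lambda>j. a * c j"]) (simp_all add: c scale_sum_right)
qed

lemma combinations_add:
  assumes "y \<in> combinations I x" and "z \<in> combinations I x"
  shows "y + z \<in> combinations I x"
proof -
  obtain c d where "y = (\<Sum>j\<in>I. poly (\<rho> (c j)) (x j))" "z = (\<Sum>j\<in>I. poly (\<rho> (d j)) (x j))"
    using assms by (auto simp: combinations_def)
  then show ?thesis
    unfolding combinations_def
    by (intro image_eqI[of _ _ "\<lambda>j. c j + d j"]) (simp_all add: scale_left_distrib sum.distrib)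
qed

lemma combinations_sum:
  assumes "\<And>k. k \<in> J \<Longrightarrow> y k \<in> combinations I x"
  shows "(\<Sum>k\<in>J. y k) \<in> combinations I x"
proof -
  have "0 \<in> combinations I x"
    unfolding combinations_def by (rule image_eqI[of _ _ "\<lambda>_. 0"]) simp_all
  then show ?thesis
    using assms by (induction J rule: infinite_finite_induct) (auto intro: combinations_add)
qed

text \<open>On \<open>u\<close>-torsion a scalar acts through its residue. Extensional coefficient
  families form a finite set, which makes spans countable by cardinality.\<close>

lemma combinations_residues:
  assumes "u \<noteq> 0" and "\<And>j. j \<in> I \<Longrightarrow> x j \<in> torsion \<rho> u"
  shows "combinations I x = (\<lambda>c. \<Sum>j\<in>I. poly (\<rho> (c j)) (x j)) ` (I \<rightarrow>\<^sub>E residues u)"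
proof
  show "combinations I x \<subseteq> (\<lambda>c. \<Sum>j\<in>I. poly (\<rho> (c j)) (x j)) ` (I \<rightarrow>\<^sub>E residues u)"
    unfolding combinations_def
  proof safe
    fix c :: "nat \<Rightarrow> 'k poly"
    let ?d = "restrict (\<lambda>j. c j mod u) I"
    have "(\<Sum>j\<in>I. poly (\<rho> (c j)) (x j)) = (\<Sum>j\<in>I. poly (\<rho> (?d j)) (x j))"
      using assms by (intro sum.cong) (simp_all add: act_mod)
    moreover have "?d \<in> I \<rightarrow>\<^sub>E residues u"
      using mod_in_residues[OF assms(1)] by auto
    ultimately show "(\<Sum>j\<in>I. poly (\<rho> (c j)) (x j)) \<in>
        (\<lambda>c. \<Sum>j\<in>I. poly (\<rho> (c j)) (x j)) ` (I \<rightarrow>\<^sub>E residues u)"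
      by (rule image_eqI)
  qed
qed (auto simp: combinations_def)

lemma card_combinations_le:
  assumes "finite I" and "u \<noteq> 0" and "\<And>j. j \<in> I \<Longrightarrow> x j \<in> torsion \<rho> u"
  shows "finite (combinations I x)" and "card (combinations I x) \<le> card (residues u) ^ card I"
proof -
  have fin: "finite (I \<rightarrow>\<^sub>E residues u)"
    using assms(1) by (intro finite_PiE) auto
  then show "finite (combinations I x)"
    using combinations_residues[of u I x] assms by auto
  show "card (combinations I x) \<le> card (residues u) ^ card I"
    using combinations_residues[of u I x] assms card_image_le[OF fin] by (simp add: card_PiE)
qed

text \<open>Two residue families with the same sum differ by scalars that independence makes
  divisible by \<open>u\<close>, hence zero.\<close>

lemma card_combinations:
  assumes "finite I" and "u \<noteq> 0" and "\<And>j. j \<in> I \<Longrightarrow> x j \<in> torsion \<rho> u"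
    and indep: "A_mod_independent \<rho> u I x"
  shows "card (combinations I x) = card (residues u) ^ card I"
proof -
  have "inj_on (\<lambda>c. \<Sum>j\<in>I. poly (\<rho> (c j)) (x j)) (I \<rightarrow>\<^sub>E residues u)"
  proof (rule inj_onI)
    fix c d assume cd: "c \<in> I \<rightarrow>\<^sub>E residues u" "d \<in> I \<rightarrow>\<^sub>E residues u"
      and eq: "(\<Sum>j\<in>I. poly (\<rho> (c j)) (x j)) = (\<Sum>j\<in>I. poly (\<rho> (d j)) (x j))"
    have "(\<Sum>j\<in>I. poly (\<rho> (c j - d j)) (x j)) = 0"
      using eq by (simp add: scale_left_diff_distrib sum_subtractf)
    then have "\<forall>j\<in>I. u dvd c j - d j"
      using indep by (auto simp: A_mod_independent_def)
    then have "c j = d j" if "j \<in> I" for j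
      using residues_dvd_imp_eq_0[OF residues_diff[of "c j" u "d j"]] cd that by (auto simp: PiE_def Pi_def)
    then show "c = d"
      using cd by (intro PiE_ext)
  qed
  then show ?thesis
    using combinations_residues[of u I x] assms by (simp add: card_image card_PiE)
qed

text \<open>If the coefficient of the new vector were prime to \<open>u\<close>, inverting it modulo
  \<open>u\<close> would put that vector in the span.\<close>

lemma A_mod_independent_insert:
  assumes u: "prime_elem u" and I: "finite I" "i \<notin> I" and indep: "A_mod_independent \<rho> u I x"
    and tors: "y \<in> torsion \<rho> u" and y: "y \<notin> combinations I x"
  shows "A_mod_independent \<rho> u (insert i I) (x(i := y))"
  unfolding A_mod_independent_def
proof (intro allI impI)
  fix c assume sum: "(\<Sum>j\<in>insert i I. poly (\<rho> (c j)) ((x(i := y)) j)) = 0"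
  have "(\<Sum>j\<in>I. poly (\<rho> (c j)) ((x(i := y)) j)) = (\<Sum>j\<in>I. poly (\<rho> (c j)) (x j))"
    using I by (intro sum.cong) auto
  with sum have sum': "poly (\<rho> (c i)) y + (\<Sum>j\<in>I. poly (\<rho> (c j)) (x j)) = 0"
    using I by simp
  have ci: "u dvd c i"
  proof (rule ccontr)
    assume "\<not> u dvd c i"
    then obtain a where a: "u dvd a * c i - 1"
      using u inverse_mod_prime by blast
    have "y = poly (\<rho> (a * c i)) y"
      using act_zero_if_dvd[OF tors a] by (simp add: scale_left_diff_distrib del: scale_scale)
    also have "\<dots> = poly (\<rho> (- a)) (\<Sum>j\<in>I. poly (\<rho> (c j)) (x j))"
      using sum' by (simp add: eq_neg_iff_add_eq_0 flip: scale_scale scale_right_distrib)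
    also have "\<dots> \<in> combinations I x"
      by (rule combinations_act) (auto simp: combinations_def)
    finally show False
      using y by simp
  qed
  then have "(\<Sum>j\<in>I. poly (\<rho> (c j)) (x j)) = 0"
    using sum' act_zero_if_dvd[OF tors] by simp
  then show "\<forall>j\<in>insert i I. u dvd c j"
    using indep ci by (auto simp: A_mod_independent_def)
qed

lemma A_mod_independent_subset:
  assumes "A_mod_independent \<rho> u J x" and "I \<subseteq> J" and "finite J"
  shows "A_mod_independent \<rho> u I x"
  unfolding A_mod_independent_def
proof (intro allI impI ballI)
  fix c j assume sum: "(\<Sum>j\<in>I. poly (\<rho> (c j)) (x j)) = 0" and j: "j \<in> I"
  have "(\<Sum>j\<in>J. poly (\<rho> (if j \<in> I then c j else 0)) (x j)) = (\<Sum>j\<in>I. poly (\<rho> (c j)) (x j))"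
    using assms(2,3) by (intro sum.mono_neutral_cong_right) auto
  then have "u dvd (if j \<in> I then c j else 0)"
    using assms(2) sum j
    by (intro assms(1)[unfolded A_mod_independent_def, rule_format]) auto
  then show "u dvd c j"
    using j by simp
qed

text \<open>Coefficients are transported along \<open>f\<close> and extended by zero. This serves to
  move a vector to an earlier index.\<close>

lemma A_independent_reindex:
  assumes "A_independent \<rho> J x" and "inj_on f I" and "f ` I \<subseteq> J" and "finite J"
    and y: "\<And>i. i \<in> I \<Longrightarrow> y i = x (f i)"
  shows "A_independent \<rho> I y"
  unfolding A_independent_def
proof (intro allI impI ballI)
  fix c i assume sum: "(\<Sum>i\<in>I. poly (\<rho> (c i)) (y i)) = 0" and i: "i \<in> I"
  define d where "d j = (if j \<in> f ` I then c (inv_into I f j) else 0)" for j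
  have "(\<Sum>j\<in>J. poly (\<rho> (d j)) (x j)) = (\<Sum>j\<in>f ` I. poly (\<rho> (d j)) (x j))"
    using assms(3,4) by (intro sum.mono_neutral_right) (auto simp: d_def)
  also have "\<dots> = (\<Sum>i\<in>I. poly (\<rho> (d (f i))) (x (f i)))"
    using assms(2) by (simp add: sum.reindex)
  also have "\<dots> = (\<Sum>i\<in>I. poly (\<rho> (c i)) (y i))"
    using assms(2) y by (intro sum.cong) (auto simp: d_def)
  finally have "\<forall>j\<in>J. d j = 0"
    using assms(1) sum by (simp add: A_independent_def)
  then have "d (f i) = 0"
    using assms(3) i by auto
  then show "c i = 0"
    using assms(2) i by (simp add: d_def)
qed

lemma A_independent_nonzero:
  assumes "A_independent \<rho> I x" and "finite I" and "i \<in> I"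
  shows "x i \<noteq> 0"
proof
  assume "x i = 0"
  then have "(\<Sum>j\<in>I. poly (\<rho> (if j = i then 1 else 0)) (x j)) = 0"
    by (intro sum.neutral) auto
  then have "(if i = i then 1 else 0 :: 'k poly) = 0"
    using assms(3) by (intro assms(1)[unfolded A_independent_def, rule_format])
  then show False
    by simp
qed

text \<open>An exchange step: a relation involving \<open>\<mu>\<close> becomes, after
  multiplication by \<open>u\<close>, a relation among the \<open>x j\<close>, and
  \<open>c k \<noteq> 0\<close> lets the coefficient of \<open>\<mu>\<close> be recovered.\<close>

lemma A_independent_divide:
  assumes indep: "A_independent \<rho> (insert k I) x" and I: "finite I" "k \<notin> I"
    and "u \<noteq> 0" and ck: "c k \<noteq> 0" and \<mu>: "poly (\<rho> u) \<mu> = (\<Sum>j\<in>insert k I. poly (\<rho> (c j)) (x j))"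
  shows "A_independent \<rho> (insert k I) (x(k := \<mu>))"
  unfolding A_independent_def
proof (intro allI impI)
  fix d assume sum: "(\<Sum>j\<in>insert k I. poly (\<rho> (d j)) ((x(k := \<mu>)) j)) = 0"
  \<comment> \<open>These are the coefficients of \<open>u\<close> times the relation, with the
    \<open>u\<close>-multiple of \<open>\<mu>\<close> expanded; at \<open>k\<close> only the
    expansion contributes.\<close>
  define f where "f j = (if j = k then d k * c k else u * d j + d k * c j)" for j
  have "(\<Sum>j\<in>I. poly (\<rho> (d j)) ((x(k := \<mu>)) j)) = (\<Sum>j\<in>I. poly (\<rho> (d j)) (x j))"
    using I by (intro sum.cong) auto
  with sum have sum': "poly (\<rho> (d k)) \<mu> + (\<Sum>j\<in>I. poly (\<rho> (d j)) (x j)) = 0"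
    using I by simp
  have "(\<Sum>j\<in>I. poly (\<rho> (f j)) (x j)) =
      (\<Sum>j\<in>I. poly (\<rho> u) (poly (\<rho> (d j)) (x j)) + poly (\<rho> (d k)) (poly (\<rho> (c j)) (x j)))"
    using I by (intro sum.cong) (auto simp: f_def scale_left_distrib)
  also have "\<dots> = poly (\<rho> u) (\<Sum>j\<in>I. poly (\<rho> (d j)) (x j)) + poly (\<rho> (d k)) (\<Sum>j\<in>I. poly (\<rho> (c j)) (x j))"
    by (simp only: sum.distrib scale_sum_right)
  finally have "(\<Sum>j\<in>insert k I. poly (\<rho> (f j)) (x j)) =
      poly (\<rho> (d k)) (poly (\<rho> u) \<mu>) + poly (\<rho> u) (\<Sum>j\<in>I. poly (\<rho> (d j)) (x j))"
    unfolding \<mu> using I by (simp add: f_def scale_right_distrib)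
  also have "\<dots> = poly (\<rho> u) (poly (\<rho> (d k)) \<mu> + (\<Sum>j\<in>I. poly (\<rho> (d j)) (x j)))"
    by (simp add: scale_right_distrib mult.commute)
  also have "\<dots> = 0"
    by (simp add: sum')
  finally have f0: "\<forall>j\<in>insert k I. f j = 0"
    using indep by (simp add: A_independent_def)
  then have "d k = 0"
    using ck by (simp add: f_def)
  moreover have "d j = 0" if "j \<in> I" for j
  proof -
    have "j \<noteq> k" "f j = 0"
      using that I f0 by auto
    then show ?thesis
      using \<open>d k = 0\<close> \<open>u \<noteq> 0\<close> by (simp add: f_def)
  qed
  ultimately show "\<forall>j\<in>insert k I. d j = 0"
    by blast
qed

text \<open>A relation with scalars not all divisible by \<open>u\<^sup>n\<close> can be multiplied by a power of \<open>u\<close>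
  until it has scalars \<open>u\<^bsup>n-1\<^esup> d\<^sub>j\<close> with some \<open>d\<^sub>j\<close> prime to \<open>u\<close>.\<close>

lemma A_mod_independent_power:
  assumes u: "u \<noteq> 0" and n: "0 < n"
  shows "A_mod_independent \<rho> (u ^ n) I x \<longleftrightarrow>
    A_mod_independent \<rho> u I (\<lambda>j. poly (\<rho> (u ^ (n - 1))) (x j))"
proof
  assume *: "A_mod_independent \<rho> (u ^ n) I x"
  show "A_mod_independent \<rho> u I (\<lambda>j. poly (\<rho> (u ^ (n - 1))) (x j))"
    unfolding A_mod_independent_def
  proof (intro allI impI ballI)
    fix c j assume "(\<Sum>j\<in>I. poly (\<rho> (c j)) (poly (\<rho> (u ^ (n - 1))) (x j))) = 0" and j: "j \<in> I"
    then have "u ^ n dvd c j * u ^ (n - 1)"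
      using *[unfolded A_mod_independent_def, rule_format, of "\<lambda>j. c j * u ^ (n - 1)" j] by simp
    moreover have "u ^ n = u * u ^ (n - 1)"
      using n by (simp flip: power_Suc)
    ultimately show "u dvd c j"
      using u by simp
  qed
next
  assume *: "A_mod_independent \<rho> u I (\<lambda>j. poly (\<rho> (u ^ (n - 1))) (x j))"
  show "A_mod_independent \<rho> (u ^ n) I x"
    unfolding A_mod_independent_def
  proof (intro allI impI)
    fix c assume sum: "(\<Sum>j\<in>I. poly (\<rho> (c j)) (x j)) = 0"
    have "k \<le> n \<Longrightarrow> \<forall>j\<in>I. u ^ k dvd c j" for k
    proof (induction k)
      case (Suc k)
      then have "\<forall>j\<in>I. \<exists>d. c j = u ^ k * d"
        by (auto elim: dvdE)
      then obtain d where d: "\<And>j. j \<in> I \<Longrightarrow> c j = u ^ k * d j"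
        by metis
      have "d j * u ^ (n - 1) = u ^ (n - 1 - k) * c j" if "j \<in> I" for j
      proof -
        have "u ^ (n - 1) = u ^ (n - 1 - k) * u ^ k"
          using Suc.prems by (simp flip: power_add)
        then show ?thesis
          using d[OF that] by simp
      qed
      then have "(\<Sum>j\<in>I. poly (\<rho> (d j)) (poly (\<rho> (u ^ (n - 1))) (x j))) =
          (\<Sum>j\<in>I. poly (\<rho> (u ^ (n - 1 - k))) (poly (\<rho> (c j)) (x j)))"
        by simp
      also have "\<dots> = 0"
        using sum by (simp del: scale_scale flip: scale_sum_right)
      finally have "\<forall>j\<in>I. u dvd d j"
        using * by (auto simp: A_mod_independent_def)
      then show ?case
        using d by (auto simp: mult.commute[of u] intro: mult_dvd_mono)
    qed simp
    then show "\<forall>j\<in>I. u ^ n dvd c j"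
      by simp
  qed
qed

end

section \<open>The lattice exponential\<close>

text \<open>If \<open>0\<close> belongs to \<open>Y\<close> it is the maximum; otherwise any element
  of \<open>Y\<close> confines the search to a finite set.\<close>

lemma (in valued_field) ex_max_w:
  assumes fin: "\<And>B. finite {y \<in> Y. ereal B \<le> w y}" and "Y \<noteq> {}"
  obtains y where "y \<in> Y" "\<And>y'. y' \<in> Y \<Longrightarrow> w y' \<le> w y"
proof (cases "0 \<in> Y")
  case True
  then show ?thesis
    using that[of 0] by simp
next
  case False
  obtain y0 where y0: "y0 \<in> Y"
    using assms(2) by blast
  then obtain v where v: "w y0 = ereal v"
    using False w_realE by metis
  let ?T = "{y \<in> Y. ereal v \<le> w y}"
  have T: "finite ?T" "?T \<noteq> {}"
    using fin y0 v by auto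
  then have "Max (w ` ?T) \<in> w ` ?T"
    by (intro Max_in) auto
  then obtain y where y: "y \<in> ?T" "w y = Max (w ` ?T)"
    by auto
  have "w y' \<le> w y" if "y' \<in> Y" for y'
  proof (cases "y' \<in> ?T")
    case True
    then show ?thesis
      using T y by simp
  next
    case False
    then show ?thesis
      using that y(1) by auto
  qed
  then show ?thesis
    using that y(1) by blast
qed

text \<open>The rank \<open>s\<close> of \<open>\<psi>\<close> is the reduction rank, called
  \<open>r'\<close> in the theorem.\<close>

locale tate_uniformized = good_drinfeld_module \<iota> w K s \<psi>
  for \<iota> :: "'k::{field,finite} poly fract \<Rightarrow> 'c::alg_closed_field"
    and w :: "'c \<Rightarrow> ereal" and K s \<psi> +
  fixes r :: nat and \<phi> :: "'k poly \<Rightarrow> 'c poly" and \<Lambda> :: "'c set" and e :: "'c \<Rightarrow> 'c"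
  assumes tate: "tate_uniformization \<iota> w K r s \<phi> \<psi> \<Lambda> e"
begin

sublocale psi: polynomial_action \<psi>
  by unfold_locales

lemma finite_lattice_ball: "finite {x \<in> \<Lambda>. ereal B \<le> w x}"
  using tate unfolding tate_uniformization_def A_lattice_def by blast

lemma w_lattice_neg: "\<mu> \<in> \<Lambda> \<Longrightarrow> \<mu> \<noteq> 0 \<Longrightarrow> w \<mu> < 0"
  using tate by (simp add: tate_uniformization_def)

lemma e_eq_0_iff: "e z = 0 \<longleftrightarrow> z \<in> \<Lambda>"
  using tate by (auto simp: tate_uniformization_def)

lemma surj_e: "surj e"
  using tate by (simp add: tate_uniformization_def)

lemma e_act: "e (poly (\<psi> a) z) = poly (\<phi> a) (e z)"
  using tate by (simp add: tate_uniformization_def)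

lemma lattice_combinations:
  obtains b where "\<Lambda> = psi.combinations {1..r - s} b"
  using tate unfolding tate_uniformization_def A_lattice_def psi.combinations_def by blast

lemma lattice_add: "x \<in> \<Lambda> \<Longrightarrow> y \<in> \<Lambda> \<Longrightarrow> x + y \<in> \<Lambda>"
  and lattice_act: "x \<in> \<Lambda> \<Longrightarrow> poly (\<psi> a) x \<in> \<Lambda>"
  and lattice_sum: "(\<And>k. k \<in> J \<Longrightarrow> f k \<in> \<Lambda>) \<Longrightarrow> (\<Sum>k\<in>J. f k) \<in> \<Lambda>" for f :: "nat \<Rightarrow> 'c"
  using lattice_combinations psi.combinations_add psi.combinations_act psi.combinations_sum by metis+

lemma lattice_0 [simp]: "0 \<in> \<Lambda>"
  using lattice_sum[of "{}"] by simp

lemma lattice_minus: "x \<in> \<Lambda> \<Longrightarrow> - x \<in> \<Lambda>"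
  using lattice_act[of x "- 1"] by simp

lemma lattice_integral_eq_0: "\<mu> \<in> \<Lambda> \<Longrightarrow> 0 \<le> w \<mu> \<Longrightarrow> \<mu> = 0"
  using w_lattice_neg[of \<mu>] by (auto simp: leD)

definition partial_exp :: "'c set \<Rightarrow> 'c \<Rightarrow> 'c" where
  "partial_exp S z = z * (\<Prod>\<mu>\<in>S. 1 - z / \<mu>)"

lemma eventually_partial_exp:
  "\<forall>\<^sub>F S in finite_subsets_at_top (\<Lambda> - {0}). ereal C < w (e z - partial_exp S z)"
  using tate unfolding tate_uniformization_def is_lattice_exp_def partial_exp_def tendsto_PInfty by blast

text \<open>By the ultrametric inequality a ball meets \<open>\<Lambda>\<close> in a finite
  subgroup. With \<open>0\<close> restored, the truncated product is a constant multiple of the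
  group polynomial of that subgroup.\<close>

lemma partial_exp_ball_add:
  fixes B :: real
  defines "S \<equiv> {x \<in> \<Lambda>. ereal B \<le> w x} - {0}"
  assumes "B \<le> 0"
  shows "partial_exp S (x + y) = partial_exp S x + partial_exp S y"
proof -
  let ?G = "{x \<in> \<Lambda>. ereal B \<le> w x}"
  have G: "?G = insert 0 S" "finite S" "0 \<notin> S"
    using finite_lattice_ball[of B] by (auto simp: S_def)
  have *: "partial_exp S z = (\<Prod>\<mu>\<in>S. - 1 / \<mu>) * (\<Prod>g\<in>?G. z - g)" for z
  proof -
    have "1 - z / \<mu> = (- 1 / \<mu>) * (z - \<mu>)" if "\<mu> \<in> S" for \<mu>
    proof -
      have "\<mu> \<noteq> 0"
        using that G(3) by metis
      then show ?thesis
        by (simp add: field_simps)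
    qed
    then have "(\<Prod>\<mu>\<in>S. 1 - z / \<mu>) = (\<Prod>\<mu>\<in>S. (- 1 / \<mu>) * (z - \<mu>))"
      by (intro prod.cong refl)
    then have "partial_exp S z = z * ((\<Prod>\<mu>\<in>S. - 1 / \<mu>) * (\<Prod>\<mu>\<in>S. z - \<mu>))"
      unfolding partial_exp_def by (simp only: prod.distrib)
    then show ?thesis
      unfolding G(1) using G(2,3) by (simp add: mult_ac)
  qed
  have "(\<Prod>g\<in>?G. x + y - g) = (\<Prod>g\<in>?G. x - g) + (\<Prod>g\<in>?G. y - g)"
  proof (rule subgroup_prod_additive)
    show "x + y \<in> ?G" if "x \<in> ?G" "y \<in> ?G" for x y
      using that w_add_ge[of x y] by (auto intro: lattice_add order_trans[of _ "min (w x) (w y)"])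
  qed (use finite_lattice_ball[of B] in \<open>auto intro: lattice_minus\<close>)
  then show ?thesis
    by (simp add: * distrib_left)
qed

text \<open>The defect of additivity vanishes for truncations to balls. Every finite subset of the
  lattice lies in a ball, so such truncations approximate \<open>e\<close> closely enough to exclude
  a nonzero defect.\<close>

lemma e_add: "e (x + y) = e x + e y"
proof (rule ccontr)
  assume "e (x + y) \<noteq> e x + e y"
  then have "e (x + y) - e x - e y \<noteq> 0"
    by (simp add: algebra_simps)
  then obtain C where C: "w (e (x + y) - e x - e y) = ereal C"
    by (rule w_realE)
  let ?close = "\<lambda>S z. ereal C < w (e z - partial_exp S z)"
  have "\<forall>\<^sub>F S in finite_subsets_at_top (\<Lambda> - {0}). ?close S (x + y) \<and> ?close S x \<and> ?close S y"
    using eventually_partial_exp by (intro eventually_conj)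
  then obtain X where X: "finite X" "X \<subseteq> \<Lambda> - {0}"
    and close: "\<And>Y. finite Y \<Longrightarrow> X \<subseteq> Y \<Longrightarrow> Y \<subseteq> \<Lambda> - {0} \<Longrightarrow> ?close Y (x + y) \<and> ?close Y x \<and> ?close Y y"
    unfolding eventually_finite_subsets_at_top by metis
  \<comment> \<open>The smallest valuation in \<open>X\<close>, capped at zero; the inserted
    \<open>0\<close> also handles empty \<open>X\<close>. The ball of this bound then contains
    \<open>X\<close>.\<close>
  define B where "B = Min (insert 0 ((\<lambda>x. real_of_ereal (w x)) ` X))"
  define S where "S = {x \<in> \<Lambda>. ereal B \<le> w x} - {0}"
  have B: "B \<le> 0"
    using X(1) by (simp add: B_def)
  have "X \<subseteq> S"
  proof
    fix \<mu> assume \<mu>: "\<mu> \<in> X"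
    then have "\<mu> \<noteq> 0" "\<mu> \<in> \<Lambda>"
      using X(2) by auto
    moreover from \<open>\<mu> \<noteq> 0\<close> obtain v where "w \<mu> = ereal v"
      by (rule w_realE)
    moreover have "B \<le> real_of_ereal (w \<mu>)"
      unfolding B_def using X(1) \<mu> by (intro Min_le) auto
    ultimately show "\<mu> \<in> S"
      by (simp add: S_def)
  qed
  then have cl: "?close S (x + y)" "?close S x" "?close S y"
    using close[of S] finite_lattice_ball[of B] by (auto simp: S_def)
  let ?d = "\<lambda>z. e z - partial_exp S z"
  have "e (x + y) - e x - e y = ?d (x + y) - (?d x + ?d y)"
    using partial_exp_ball_add[OF B, of x y] by (simp add: S_def algebra_simps)
  also have "ereal C < w \<dots>"
  proof -
    have "ereal C < min (w (?d x)) (w (?d y))"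
      using cl by simp
    also have "\<dots> \<le> w (?d x + ?d y)"
      by (rule w_add_ge)
    finally have "ereal C < min (w (?d (x + y))) (w (?d x + ?d y))"
      using cl by simp
    also have "\<dots> \<le> w (?d (x + y) - (?d x + ?d y))"
      by (rule w_diff_ge)
    finally show ?thesis .
  qed
  finally show False
    using C by simp
qed

text \<open>Every point is of the form \<open>e z\<close>, and \<open>e\<close> is additive and
  equivariant, so the module laws descend from \<open>\<psi>\<close>.\<close>

sublocale phi: polynomial_action \<phi>
proof
  fix a b :: "'k poly" and x y :: 'c
  obtain z z' where z: "x = e z" "y = e z'"
    using surj_e by (metis surjD)
  show "poly (\<phi> a) (x + y) = poly (\<phi> a) x + poly (\<phi> a) y"
    unfolding z e_add[symmetric] e_act[symmetric] act_add ..
  show "poly (\<phi> (a + b)) x = poly (\<phi> a) x + poly (\<phi> b) x"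
    unfolding z e_act[symmetric] act.scale_left_distrib e_add ..
  show "poly (\<phi> a) (poly (\<phi> b) x) = poly (\<phi> (a * b)) x"
    unfolding z e_act[symmetric] act.scale_scale ..
  show "poly (\<phi> 1) x = x"
    unfolding z e_act[symmetric] act.scale_one ..
qed

sublocale exp: module_hom "\<lambda>a. poly (\<psi> a)" "\<lambda>a. poly (\<phi> a)" e
  by unfold_locales (simp_all add: e_add e_act)

section \<open>Valuations of the lattice exponential\<close>

lemma w_e_approx:
  assumes "z \<noteq> 0"
  obtains S where "S \<subseteq> \<Lambda> - {0}" "w z < w (e z - partial_exp S z)"
proof -
  obtain v where v: "w z = ereal v"
    using assms by (rule w_realE)
  obtain X where X: "finite X" "X \<subseteq> \<Lambda> - {0}"
    and "\<And>Y. finite Y \<Longrightarrow> X \<subseteq> Y \<Longrightarrow> Y \<subseteq> \<Lambda> - {0} \<Longrightarrow> ereal v < w (e z - partial_exp Y z)"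
    using eventually_partial_exp[of v z] unfolding eventually_finite_subsets_at_top by metis
  then show ?thesis
    using that[of X] v by simp
qed

text \<open>Each factor \<open>1 - z / \<mu>\<close> has valuation 0 because \<open>\<mu>\<close>
  dominates \<open>z\<close>.\<close>

lemma w_e_eq:
  assumes z: "\<And>\<mu>. \<mu> \<in> \<Lambda> \<Longrightarrow> \<mu> \<noteq> 0 \<Longrightarrow> w \<mu> < w z"
  shows "w (e z) = w z"
proof (cases "z = 0")
  case True
  then show ?thesis
    by simp
next
  case False
  then obtain S where S: "S \<subseteq> \<Lambda> - {0}" "w z < w (e z - partial_exp S z)"
    by (rule w_e_approx)
  have "w (1 - z / \<mu>) = 0" if "\<mu> \<in> S" for \<mu>
  proof -
    have \<mu>: "\<mu> \<noteq> 0" "w \<mu> < w z"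
      using that S z by auto
    obtain m where m: "w \<mu> = ereal m"
      using \<mu>(1) by (rule w_realE)
    have "w (- z + \<mu>) = w \<mu>"
      using \<mu> by (intro w_add_eq(2)) simp
    moreover have "1 - z / \<mu> = (- z + \<mu>) / \<mu>"
      using \<mu> by (simp add: field_simps)
    ultimately show ?thesis
      using \<mu>(1) m by (simp add: w_divide)
  qed
  then have "w (\<Prod>\<mu>\<in>S. 1 - z / \<mu>) = 0"
    by (rule w_prod_eq_0)
  then have "w (partial_exp S z) = w z"
    by (simp add: partial_exp_def w_mult)
  then show ?thesis
    using w_add_eq(1)[of "partial_exp S z" "e z - partial_exp S z"] S(2) by simp
qed

text \<open>Each factor has valuation at most 0: if \<open>\<mu>\<close> dominates \<open>z\<close>
  the factor is a unit, and otherwise the hypothesis that \<open>z\<close> is reduced gives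
  \<open>w (z - \<mu>) \<le> w z \<le> w \<mu>\<close>.\<close>

lemma w_e_le:
  assumes z: "\<And>\<mu>. \<mu> \<in> \<Lambda> \<Longrightarrow> w (z - \<mu>) \<le> w z"
  shows "w (e z) \<le> w z"
proof (cases "z = 0")
  case True
  then show ?thesis
    by simp
next
  case False
  then obtain S where S: "S \<subseteq> \<Lambda> - {0}" "w z < w (e z - partial_exp S z)"
    by (rule w_e_approx)
  have "w (1 - z / \<mu>) \<le> 0" if "\<mu> \<in> S" for \<mu>
  proof -
    have \<mu>: "\<mu> \<noteq> 0" "\<mu> \<in> \<Lambda>"
      using that S by auto
    obtain m where m: "w \<mu> = ereal m"
      using \<mu>(1) by (rule w_realE)
    have "w (\<mu> - z) \<le> w \<mu>"
    proof (cases "w \<mu> < w z")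
      case True
      then have "w (- z + \<mu>) = w \<mu>"
        by (intro w_add_eq(2)) simp
      then show ?thesis
        by simp
    next
      case False
      then show ?thesis
        using z[OF \<mu>(2)] w_diff_commute[of z \<mu>] by simp
    qed
    moreover have "1 - z / \<mu> = (\<mu> - z) / \<mu>"
      using \<mu> by (simp add: field_simps)
    ultimately show ?thesis
      using \<mu>(1) m by (cases "w (\<mu> - z)") (simp_all add: w_divide)
  qed
  then have "w (\<Prod>\<mu>\<in>S. 1 - z / \<mu>) \<le> 0"
    by (rule w_prod_le_0)
  then have "w (partial_exp S z) \<le> w z"
    unfolding partial_exp_def w_mult by (metis add.right_neutral add_left_mono)
  then show ?thesis
    using w_add_eq(1)[of "partial_exp S z" "e z - partial_exp S z"] S(2) by simp
qed

lemma lattice_reduce: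
  obtains \<mu> where "\<mu> \<in> \<Lambda>" "\<And>\<nu>. \<nu> \<in> \<Lambda> \<Longrightarrow> w (z - \<mu> - \<nu>) \<le> w (z - \<mu>)"
proof -
  let ?Y = "(\<lambda>\<mu>. z - \<mu>) ` \<Lambda>"
  have fin: "finite {y \<in> ?Y. ereal B \<le> w y}" for B
  proof -
    \<comment> \<open>A bound below both \<open>B\<close> and \<open>w z\<close>, so that
      \<open>z - \<mu>\<close> in the ball of \<open>B\<close> forces \<open>\<mu>\<close> into the
      ball of \<open>B'\<close>.\<close>
    obtain B' where B': "ereal B' \<le> ereal B" "ereal B' \<le> w z"
    proof (cases "z = 0")
      case False
      then obtain v where "w z = ereal v"
        by (rule w_realE)
      then show ?thesis
        using that[of "min B v"] by simp
    qed (use that in auto)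
    have "{y \<in> ?Y. ereal B \<le> w y} \<subseteq> (\<lambda>\<mu>. z - \<mu>) ` {\<mu> \<in> \<Lambda>. ereal B' \<le> w \<mu>}"
    proof safe
      fix \<mu> assume \<mu>: "\<mu> \<in> \<Lambda>" "ereal B \<le> w (z - \<mu>)"
      have "ereal B' \<le> min (w z) (w (z - \<mu>))"
        using B' \<mu>(2) by (simp add: order_trans[of _ "ereal B"])
      also have "\<dots> \<le> w (z - (z - \<mu>))"
        by (rule w_diff_ge)
      finally show "z - \<mu> \<in> (\<lambda>\<mu>. z - \<mu>) ` {\<mu> \<in> \<Lambda>. ereal B' \<le> w \<mu>}"
        using \<mu> by simp
    qed
    then show ?thesis
      using finite_lattice_ball[of B'] finite_surj by blast
  qed
  have "?Y \<noteq> {}"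
    using lattice_0 by blast
  then obtain y where y: "y \<in> ?Y" "\<And>y'. y' \<in> ?Y \<Longrightarrow> w y' \<le> w y"
    using ex_max_w[of ?Y] fin by metis
  then obtain \<mu> where \<mu>: "\<mu> \<in> \<Lambda>" "y = z - \<mu>"
    by blast
  show ?thesis
  proof (rule that[OF \<mu>(1)])
    fix \<nu> assume "\<nu> \<in> \<Lambda>"
    then have "z - (\<mu> + \<nu>) \<in> ?Y"
      using \<mu>(1) by (intro imageI lattice_add)
    then show "w (z - \<mu> - \<nu>) \<le> w (z - \<mu>)"
      using y(2) \<mu>(2) by (metis diff_diff_eq)
  qed
qed

end

section \<open>Successive minima\<close>

context good_drinfeld_module
begin

lemma w_act_less_iff:
  assumes "a \<noteq> 0" and "w x < 0"
  shows "w (poly (\<psi> a) x) < w (poly (\<psi> a) y) \<longleftrightarrow> w x < w y"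
proof (cases "w y < 0")
  case True
  obtain v v' where v: "w x = ereal v" "w y = ereal v'"
    using w_negE[OF assms(2)] w_negE[OF True] by metis
  have pos: "0 < real (CARD('k) ^ (s * degree a))"
    by simp
  show ?thesis
    using w_act_neg[OF assms(2,1)] w_act_neg[OF True assms(1)] mult_less_cancel_left_pos[OF pos, of v v']
    by (simp add: v)
next
  case False
  then have "w x < w y" "0 \<le> w (poly (\<psi> a) y)" "w (poly (\<psi> a) x) < 0"
    using assms w_act_nonneg[of y a] w_act_less_0_iff[of a x] by auto
  then show ?thesis
    by (metis order_less_le_trans)
qed

text \<open>A residue has smaller degree than \<open>a\<close>, so it stretches negative valuations
  by a smaller factor.\<close>

lemma w_act_less_act_residue:
  assumes "a \<noteq> 0" and "c \<in> residues a" and "w x < 0" and "w x \<le> w y"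
  shows "w (poly (\<psi> a) x) < w (poly (\<psi> c) y)"
proof (cases "c = 0 \<or> \<not> w y < 0")
  case True
  then have "0 \<le> w (poly (\<psi> c) y)"
    using w_act_nonneg[of y c] by auto
  then show ?thesis
    using assms w_act_less_0_iff[of a x] by (metis order_less_le_trans)
next
  case False
  then have c: "c \<noteq> 0" and y: "w y < 0"
    by auto
  obtain v v' where v: "w x = ereal v" "v < 0" "w y = ereal v'"
    using w_negE[OF assms(3)] w_negE[OF y] by metis
  have "CARD('k) ^ (s * degree c) < CARD('k) ^ (s * degree a)"
    using c assms(2) q_ge_2 s_ge_1 by (intro power_strict_increasing) (auto simp: residues_def)
  then have "real (CARD('k) ^ (s * degree c)) < real (CARD('k) ^ (s * degree a))"
    by (simp only: of_nat_less_iff)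
  then have "real (CARD('k) ^ (s * degree a)) * v < real (CARD('k) ^ (s * degree c)) * v"
    using v(2) by (rule mult_strict_right_mono_neg)
  also have "\<dots> \<le> real (CARD('k) ^ (s * degree c)) * v'"
    using assms(4) v by (intro mult_left_mono) auto
  finally show ?thesis
    using w_act_neg[OF assms(3,1)] w_act_neg[OF y c] by (simp add: v)
qed

end

context tate_uniformized
begin

lemma lattice_torsion_free: "y \<in> \<Lambda> \<Longrightarrow> poly (\<psi> a) y = 0 \<Longrightarrow> a = 0 \<or> y = 0"
  using w_lattice_neg[of y] w_act_less_0_iff[of a y] by auto

text \<open>Since \<open>x k\<close> has the least valuation in the family, its
  \<open>u\<close>-multiple lies below every term with a residue coefficient, hence below the
  \<open>u\<close>-multiple of \<open>\<mu>\<close>; the action of \<open>u\<close> preserves this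
  comparison.\<close>

lemma divide_combination:
  assumes u: "u \<noteq> 0" and I: "finite I" "k \<in> I" and indep: "A_independent \<psi> I x"
    and xk: "x k \<in> \<Lambda>" "\<And>j. j \<in> I \<Longrightarrow> w (x k) \<le> w (x j)"
    and c: "\<And>j. j \<in> I \<Longrightarrow> c j \<in> residues u" "c k \<noteq> 0"
    and \<mu>: "poly (\<psi> u) \<mu> = (\<Sum>j\<in>I. poly (\<psi> (c j)) (x j))"
  shows "A_independent \<psi> I (x(k := \<mu>))" and "w (x k) < w \<mu>"
proof -
  have I': "I = insert k (I - {k})"
    using I by auto
  have "x k \<noteq> 0"
    using psi.A_independent_nonzero[OF indep I] .
  then have neg: "w (x k) < 0"
    using w_lattice_neg xk(1) by blast
  show "A_independent \<psi> I (x(k := \<mu>))"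
    using psi.A_independent_divide[of k "I - {k}" x u c \<mu>] indep I u c(2) \<mu> I' by simp
  have "w (poly (\<psi> u) (x k)) < w (\<Sum>j\<in>I. poly (\<psi> (c j)) (x j))"
  proof (rule w_sum_gt)
    show "w (poly (\<psi> u) (x k)) < w (poly (\<psi> (c j)) (x j))" if "j \<in> I" for j
      using w_act_less_act_residue u c(1) neg xk(2) that by blast
    show "w (poly (\<psi> u) (x k)) < \<infinity>"
      using w_act_less_0_iff[OF u, of "x k"] neg by auto
  qed
  then show "w (x k) < w \<mu>"
    unfolding \<mu>[symmetric] using w_act_less_iff[OF u neg] by blast
qed

end

text \<open>The hypothesis \<open>bound\<close> expresses the size of \<open>u^n\<close> by
  valuations: the \<open>u^n\<close>-multiple of the shortest lattice minimum is longer than the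
  longest minimum.\<close>

locale smb_setting = tate_uniformized \<iota> w K s \<psi> r \<phi> \<Lambda> e
  for \<iota> :: "'k::{field,finite} poly fract \<Rightarrow> 'c::alg_closed_field"
    and w :: "'c \<Rightarrow> ereal" and K s \<psi> r \<phi> \<Lambda> e +
  fixes \<beta> lam :: "nat \<Rightarrow> 'c" and u :: "'k poly" and n :: nat
  assumes s_less_r: "s < r"
    and lattice_smb: "lattice_SMB w \<psi> \<Lambda> s r \<beta>"
    and prime_u: "prime_elem u" and n_pos: "0 < n"
    and bound: "w (poly (\<psi> (u ^ n)) (\<beta> (s + 1))) < w (\<beta> r)"
    and torsion_smb: "torsion_SMB w \<phi> r (u ^ n) lam"
begin

lemma u_neq_0 [simp]: "u \<noteq> 0"
  using prime_u by auto

lemma u_power_Suc: "u ^ n = u * u ^ (n - 1)"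
  using n_pos by (simp flip: power_Suc)

section \<open>Successive minima of the lattice modulo \<open>u\<close>\<close>

lemma omega:
  assumes "i \<in> {s + 1..r}"
  shows "\<beta> i \<in> \<Lambda>" and "A_independent \<psi> {s + 1..i} \<beta>"
    and "y \<in> \<Lambda> \<Longrightarrow> A_independent \<psi> {s + 1..i} (\<beta>(i := y)) \<Longrightarrow> w y \<le> w (\<beta> i)"
  using lattice_smb assms s_ge_1 by (auto simp: lattice_SMB_def val_abs_le_iff)

lemma omega_neg: "i \<in> {s + 1..r} \<Longrightarrow> w (\<beta> i) < 0"
  using w_lattice_neg[OF omega(1)] psi.A_independent_nonzero[OF omega(2), of i i] by simp

lemma w_lattice_le:
  assumes "y \<in> \<Lambda>" and "y \<noteq> 0"
  shows "w y \<le> w (\<beta> (s + 1))"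
proof (rule omega(3))
  show "A_independent \<psi> {s + 1..s + 1} (\<beta>(s + 1 := y))"
    using lattice_torsion_free assms by (auto simp: A_independent_def)
qed (use s_less_r assms in auto)

text \<open>The later vector \<open>\<beta> j\<close> is itself a competitor at position
  \<open>i\<close>.\<close>

lemma omega_mono:
  assumes "s + 1 \<le> i" and "i \<le> j" and "j \<le> r"
  shows "w (\<beta> j) \<le> w (\<beta> i)"
proof (rule omega(3))
  show "A_independent \<psi> {s + 1..i} (\<beta>(i := \<beta> j))"
    by (rule psi.A_independent_reindex[of "{s + 1..j}" \<beta> "id(i := j)"])
      (use assms omega(2)[of j] in \<open>auto simp: inj_on_def\<close>)
qed (use assms in \<open>auto intro: omega(1)\<close>)

lemma w_e_small: "w (\<beta> (s + 1)) < w z \<Longrightarrow> w (e z) = w z"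
  by (rule w_e_eq) (use w_lattice_le in \<open>auto intro: le_less_trans\<close>)

text \<open>Two small preimages differ by a lattice element shorter than the shortest nonzero
  one.\<close>

lemma e_inj_small:
  assumes "w (\<beta> (s + 1)) < w z" and "w (\<beta> (s + 1)) < w z'" and "e z = e z'"
  shows "z = z'"
proof (rule ccontr)
  assume "z \<noteq> z'"
  have "z - z' \<in> \<Lambda>"
    using assms(3) by (simp add: exp.diff flip: e_eq_0_iff)
  then have "w (z - z') \<le> w (\<beta> (s + 1))"
    using \<open>z \<noteq> z'\<close> by (intro w_lattice_le) auto
  then show False
    using w_diff_ge[of z z'] assms(1,2) by (auto simp: min_def split: if_splits)
qed

lemma torsion_small:
  assumes "z \<in> torsion \<psi> a" and "a \<noteq> 0"
  shows "w (\<beta> (s + 1)) < w z"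
  using w_torsion[OF assms] omega_neg[of "s + 1"] s_less_r by (auto intro: less_le_trans)

text \<open>At the last index \<open>k\<close> with a nonzero coefficient, \<open>\<mu>\<close>
  could replace \<open>\<beta> k\<close> and would be strictly shorter, against minimality.\<close>

lemma omega_mod_independent:
  assumes "i \<le> r" and c: "\<And>j. j \<in> {s + 1..i} \<Longrightarrow> c j \<in> residues u"
    and "\<mu> \<in> \<Lambda>" and \<mu>: "poly (\<psi> u) \<mu> = (\<Sum>j\<in>{s + 1..i}. poly (\<psi> (c j)) (\<beta> j))"
    and "j \<in> {s + 1..i}"
  shows "c j = 0"
proof (rule ccontr)
  assume "c j \<noteq> 0"
  define k where "k = Max {j \<in> {s + 1..i}. c j \<noteq> 0}"
  have "k \<in> {j \<in> {s + 1..i}. c j \<noteq> 0}"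
    unfolding k_def using assms(5) \<open>c j \<noteq> 0\<close> by (intro Max_in) auto
  then have k: "k \<in> {s + 1..i}" "c k \<noteq> 0"
    by auto
  have max: "c j = 0" if "j \<in> {s + 1..i}" "k < j" for j
  proof (rule ccontr)
    assume "c j \<noteq> 0"
    then have "j \<le> k"
      unfolding k_def using that(1) by (intro Max_ge) auto
    then show False
      using that(2) by simp
  qed
  have "poly (\<psi> u) \<mu> = (\<Sum>j\<in>{s + 1..k}. poly (\<psi> (c j)) (\<beta> j))"
    unfolding \<mu> using k max by (intro sum.mono_neutral_right) auto
  then have "A_independent \<psi> {s + 1..k} (\<beta>(k := \<mu>))" "w (\<beta> k) < w \<mu>"
    using divide_combination[of u "{s + 1..k}" k \<beta> c \<mu>] k omega[of k] omega_mono[of _ k] c assms(1) by auto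
  then show False
    using omega(3)[of k \<mu>] k assms(1,3) by auto
qed

section \<open>Torsion minima as vectors over the field \<open>A/u\<close>\<close>

definition lam' :: "nat \<Rightarrow> 'c" where
  "lam' j = poly (\<phi> (u ^ (n - 1))) (lam j)"

lemma lam_torsion: "i \<in> {1..r} \<Longrightarrow> lam i \<in> torsion \<phi> (u ^ n)"
  using torsion_smb by (simp add: torsion_SMB_def)

lemma lam'_torsion: "i \<in> {1..r} \<Longrightarrow> lam' i \<in> torsion \<phi> u"
  unfolding lam'_def using lam_torsion u_power_Suc phi.torsion_mult by metis

lemma lam'_independent:
  assumes "i \<le> r"
  shows "A_mod_independent \<phi> u {1..i} lam'"
proof -
  have "A_mod_independent \<phi> (u ^ n) {1..r} lam"
    using torsion_smb s_less_r by (simp add: torsion_SMB_def)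
  then have "A_mod_independent \<phi> u {1..r} lam'"
    unfolding phi.A_mod_independent_power[OF u_neq_0 n_pos] lam'_def .
  then show ?thesis
    by (rule phi.A_mod_independent_subset) (use assms in auto)
qed

text \<open>To compete with \<open>lam i\<close>, a torsion point only needs its
  \<open>u^(n-1)\<close>-multiple outside the span of the earlier \<open>lam'\<close>.\<close>

lemma lam_maximal:
  assumes i: "i \<in> {1..r}" and y: "y \<in> torsion \<phi> (u ^ n)"
    and new: "poly (\<phi> (u ^ (n - 1))) y \<notin> phi.combinations {1..<i} lam'"
  shows "w y \<le> w (lam i)"
proof -
  have I: "{1..i} = insert i {1..<i}"
    using i by auto
  have "A_mod_independent \<phi> u {1..i} (lam'(i := poly (\<phi> (u ^ (n - 1))) y))"
    unfolding I
  proof (rule phi.A_mod_independent_insert[OF prime_u])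
    show "A_mod_independent \<phi> u {1..<i} lam'"
      using i by (intro phi.A_mod_independent_subset[OF lam'_independent[of i]]) auto
    show "poly (\<phi> (u ^ (n - 1))) y \<in> torsion \<phi> u"
      using y u_power_Suc phi.torsion_mult by metis
  qed (use new in auto)
  moreover have "lam'(i := poly (\<phi> (u ^ (n - 1))) y) = (\<lambda>j. poly (\<phi> (u ^ (n - 1))) ((lam(i := y)) j))"
    by (auto simp: lam'_def)
  ultimately have "A_mod_independent \<phi> (u ^ n) {1..i} (lam(i := y))"
    using n_pos by (simp add: phi.A_mod_independent_power)
  then show ?thesis
    using torsion_smb i y by (simp add: torsion_SMB_def)
qed

text \<open>Together, \<open>\<psi>[u\<^sup>n]\<close> and the \<open>u\<^sup>n\<close>-division points of \<open>\<beta>\<^bsub>s+1\<^esub>, \<dots>, \<beta>\<^sub>i\<close> generate a subspace of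
  dimension \<open>i\<close> over \<open>A/u\<close>, so they cannot all map into the span of \<open>\<lambda>\<^sub>1, \<dots>, \<lambda>\<^bsub>i-1\<^esub>\<close>.\<close>

lemma exists_independent_division_point:
  assumes i: "i \<in> {1..r}"
  obtains z where "poly (\<psi> (u ^ n)) z = 0 \<or> (\<exists>j\<in>{s + 1..i}. poly (\<psi> (u ^ n)) z = \<beta> j)"
    and "poly (\<phi> (u ^ (n - 1))) (e z) \<notin> phi.combinations {1..<i} lam'"
proof (rule ccontr)
  assume no: "\<not> thesis"
  let ?J = "{s + 1..i}" and ?U = "phi.combinations {1..<i} lam'"
  let ?D = "(?J \<rightarrow>\<^sub>E residues u) \<times> torsion \<psi> u"
  note hyp = that
  have in_U: "poly (\<phi> (u ^ (n - 1))) (e z) \<in> ?U"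
    if "poly (\<psi> (u ^ n)) z = 0 \<or> (\<exists>j\<in>?J. poly (\<psi> (u ^ n)) z = \<beta> j)" for z
    using no hyp[OF that] by blast
  have "\<forall>j. \<exists>z. poly (\<psi> (u ^ n)) z = \<beta> j"
    using act_surj[of "u ^ n"] by (metis u_neq_0 power_not_zero)
  then obtain \<zeta> where \<zeta>: "\<And>j. poly (\<psi> (u ^ n)) (\<zeta> j) = \<beta> j"
    by metis
  define g where "g c \<tau> = (\<Sum>j\<in>?J. poly (\<psi> (c j)) (poly (\<psi> (u ^ (n - 1))) (\<zeta> j))) + \<tau>" for c \<tau>
  have act_g: "poly (\<psi> u) (g c \<tau>) = (\<Sum>j\<in>?J. poly (\<psi> (c j)) (\<beta> j))" if "\<tau> \<in> torsion \<psi> u" for c \<tau>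
  proof -
    have "poly (\<psi> u) (poly (\<psi> (c j)) (poly (\<psi> (u ^ (n - 1))) (\<zeta> j))) = poly (\<psi> (c j)) (\<beta> j)" for j
      unfolding \<zeta>[symmetric] u_power_Suc by (simp add: mult_ac)
    then show ?thesis
      using that by (simp add: g_def torsion_def act.scale_right_distrib act.scale_sum_right
          del: act.scale_scale)
  qed
  \<comment> \<open>Points with equal images differ by a lattice vector whose
    \<open>u\<close>-multiple is a residue combination of the \<open>\<beta> j\<close>, so the
    coefficients agree. The torsion parts then differ by an integral lattice element, which is
    zero.\<close>
  have "inj_on (\<lambda>(c, \<tau>). e (g c \<tau>)) ?D"
  proof (rule inj_onI, clarify)
    fix c \<tau> c' \<tau>'
    assume c: "c \<in> ?J \<rightarrow>\<^sub>E residues u" and c': "c' \<in> ?J \<rightarrow>\<^sub>E residues u"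
      and \<tau>: "\<tau> \<in> torsion \<psi> u" "\<tau>' \<in> torsion \<psi> u" and eq: "e (g c \<tau>) = e (g c' \<tau>')"
    define \<mu> where "\<mu> = g c \<tau> - g c' \<tau>'"
    have \<mu>: "\<mu> \<in> \<Lambda>"
      using eq by (simp add: \<mu>_def exp.diff flip: e_eq_0_iff)
    have "poly (\<psi> u) \<mu> = (\<Sum>j\<in>?J. poly (\<psi> (c j - c' j)) (\<beta> j))"
      by (simp add: \<mu>_def act.scale_right_diff_distrib act_g \<tau> act.scale_left_diff_distrib sum_subtractf)
    moreover have "c j - c' j \<in> residues u" if "j \<in> ?J" for j
      using c c' that by (intro residues_diff) auto
    ultimately have "c j - c' j = 0" if "j \<in> ?J" for j
      using omega_mod_independent[of i "\<lambda>j. c j - c' j" \<mu> j] i \<mu> that by simp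
    then have cc: "c = c'"
      using c c' by (intro PiE_ext) auto
    have "\<tau> - \<tau>' \<in> \<Lambda>"
      using \<mu> by (simp add: \<mu>_def g_def cc)
    moreover have "0 \<le> w (\<tau> - \<tau>')"
      using \<tau> w_torsion[of "\<tau> - \<tau>'" u] by (simp add: torsion_def act.scale_right_diff_distrib)
    ultimately show "c = c' \<and> \<tau> = \<tau>'"
      using lattice_integral_eq_0[of "\<tau> - \<tau>'"] cc by simp
  qed
  moreover have "(\<lambda>(c, \<tau>). e (g c \<tau>)) ` ?D \<subseteq> ?U"
  proof clarify
    fix c \<tau> assume "c \<in> ?J \<rightarrow>\<^sub>E residues u" and \<tau>: "\<tau> \<in> torsion \<psi> u"
    obtain z where z: "poly (\<psi> (u ^ (n - 1))) z = \<tau>"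
      using act_surj[of "u ^ (n - 1)" \<tau>] by auto
    have "poly (\<psi> (u ^ n)) z = poly (\<psi> u) (poly (\<psi> (u ^ (n - 1))) z)"
      by (simp add: u_power_Suc)
    also have "\<dots> = 0"
      unfolding z using \<tau> by (simp add: torsion_def)
    finally have "poly (\<phi> (u ^ (n - 1))) (e z) \<in> ?U"
      by (intro in_U) simp
    then have "e \<tau> \<in> ?U"
      unfolding e_act[symmetric] z .
    moreover have "poly (\<phi> (c j)) (poly (\<phi> (u ^ (n - 1))) (e (\<zeta> j))) \<in> ?U" if "j \<in> ?J" for j
      using \<zeta> that by (intro phi.combinations_act in_U) blast
    ultimately show "e (g c \<tau>) \<in> ?U"
      unfolding g_def e_add exp.sum e_act
      by (intro phi.combinations_add phi.combinations_sum) auto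
  qed
  moreover have U: "finite ?U" "card ?U \<le> card (residues u) ^ (i - 1)"
    using phi.card_combinations_le[of "{1..<i}" u lam'] lam'_torsion i by auto
  ultimately have "card ?D \<le> card ?U"
    by (intro card_inj_on_le)
  \<comment> \<open>The exponent is at least \<open>i\<close>: for \<open>i \<le> s\<close> the set
    \<open>?J\<close> is empty and torsion alone contributes \<open>s\<close>; otherwise the
    exponent is exactly \<open>i\<close>. The span \<open>?U\<close> allows only
    \<open>i - 1\<close>.\<close>
  moreover have "card ?D = card (residues u) ^ (card ?J + s)"
    by (simp add: card_cartesian_product card_PiE card_torsion power_add card_residues mult.commute[of s]
        flip: power_mult)
  ultimately have "card (residues u) ^ (card ?J + s) \<le> card (residues u) ^ (i - 1)"
    using U by simp
  moreover have "1 < card (residues u)"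
    unfolding card_residues using q_ge_2 degree_gt_0_if_prime[OF prime_u] by (intro one_less_power) auto
  ultimately have "card ?J + s \<le> i - 1"
    by (rule power_le_imp_le_exp[rotated])
  then show False
    using i by auto
qed

text \<open>The point outside the span of the earlier \<open>lam'\<close> competes with
  \<open>lam i\<close>. It is small, by integrality of torsion or by \<open>bound\<close>, and
  \<open>e\<close> preserves its valuation. For \<open>i \<le> s\<close> it must be torsion, hence
  integral.\<close>

lemma w_lam:
  assumes i: "i \<in> {1..r}"
  shows "w (\<beta> (s + 1)) < w (lam i)" and "i \<le> s \<Longrightarrow> 0 \<le> w (lam i)"
proof -
  obtain z where z: "poly (\<psi> (u ^ n)) z = 0 \<or> (\<exists>j\<in>{s + 1..i}. poly (\<psi> (u ^ n)) z = \<beta> j)"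
    and new: "poly (\<phi> (u ^ (n - 1))) (e z) \<notin> phi.combinations {1..<i} lam'"
    using exists_independent_division_point[OF i] .
  have "poly (\<psi> (u ^ n)) z \<in> \<Lambda>"
    using z omega(1) i by auto
  then have "e z \<in> torsion \<phi> (u ^ n)"
    by (simp add: torsion_def e_eq_0_iff flip: e_act)
  then have le: "w (e z) \<le> w (lam i)"
    using lam_maximal[OF i] new by blast
  have "w (\<beta> (s + 1)) < w z"
  proof (cases "poly (\<psi> (u ^ n)) z = 0")
    case True
    then show ?thesis
      using torsion_small[of z "u ^ n"] by (simp add: torsion_def)
  next
    case False
    then obtain j where j: "j \<in> {s + 1..i}" "poly (\<psi> (u ^ n)) z = \<beta> j"
      using z by blast
    have "w (poly (\<psi> (u ^ n)) (\<beta> (s + 1))) < w (poly (\<psi> (u ^ n)) z)"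
      using bound omega_mono[of j r] j i by (auto intro: less_le_trans)
    then show ?thesis
      using w_act_less_iff[of "u ^ n" "\<beta> (s + 1)" z] omega_neg[of "s + 1"] s_less_r by simp
  qed
  then show "w (\<beta> (s + 1)) < w (lam i)"
    using w_e_small[of z] le by simp
  show "0 \<le> w (lam i)" if "i \<le> s"
  proof -
    have tors: "z \<in> torsion \<psi> (u ^ n)"
      using z that by (auto simp: torsion_def)
    then have "0 \<le> w z"
      by (rule w_torsion) simp
    also have "\<dots> = w (e z)"
      using torsion_small[OF tors] by (simp add: w_e_small)
    finally show ?thesis
      using le by simp
  qed
qed

text \<open>A preimage reduced modulo \<open>\<Lambda>\<close> has valuation at least that of
  \<open>lam i\<close>, so it is small; small preimages are unique by
  \<open>e_inj_small\<close>.\<close>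

lemma ex1_small_preimage:
  assumes i: "i \<in> {1..r}"
  shows "\<exists>!z. w (\<beta> (s + 1)) < w z \<and> e z = lam i"
proof (rule ex_ex1I)
  obtain z where z: "lam i = e z"
    using surj_e by (metis surjD)
  obtain \<mu> where \<mu>: "\<mu> \<in> \<Lambda>" "\<And>\<nu>. \<nu> \<in> \<Lambda> \<Longrightarrow> w (z - \<mu> - \<nu>) \<le> w (z - \<mu>)"
    using lattice_reduce[of z] by blast
  have "e (z - \<mu>) = lam i"
    using \<mu>(1) e_eq_0_iff[of \<mu>] by (simp add: exp.diff z)
  moreover have "w (e (z - \<mu>)) \<le> w (z - \<mu>)"
    using \<mu>(2) by (rule w_e_le)
  ultimately show "\<exists>z. w (\<beta> (s + 1)) < w z \<and> e z = lam i"
    using w_lam(1)[OF i] by (metis less_le_trans)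
next
  fix y z assume "w (\<beta> (s + 1)) < w y \<and> e y = lam i" "w (\<beta> (s + 1)) < w z \<and> e z = lam i"
  then show "y = z"
    using e_inj_small[of y z] by simp
qed

section \<open>Arbitrary small preimages of the torsion minima\<close>

context
  fixes \<omega>' :: "nat \<Rightarrow> 'c"
  assumes small: "\<And>i. i \<in> {1..r} \<Longrightarrow> w (\<beta> (s + 1)) < w (\<omega>' i)"
    and e_preimage: "\<And>i. i \<in> {1..r} \<Longrightarrow> e (\<omega>' i) = lam i"
begin

lemma w_preimage: "i \<in> {1..r} \<Longrightarrow> w (\<omega>' i) = w (lam i)"
  using w_e_small[OF small] e_preimage by simp

lemma e_combination:
  assumes "I \<subseteq> {1..r}"
  shows "e (\<Sum>j\<in>I. poly (\<psi> (c j)) (\<omega>' j)) = (\<Sum>j\<in>I. poly (\<phi> (c j)) (lam j))"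
  unfolding exp.sum e_act using assms e_preimage by (intro sum.cong) auto

lemma act_preimage_in_lattice: "i \<in> {1..r} \<Longrightarrow> poly (\<psi> (u ^ n)) (\<omega>' i) \<in> \<Lambda>"
  using lam_torsion[of i] by (simp add: torsion_def e_preimage e_act flip: e_eq_0_iff)

text \<open>The \<open>u^n\<close>-multiple is at once integral and in the lattice, hence
  zero.\<close>

lemma preimage_torsion:
  assumes "i \<in> {1..s}"
  shows "\<omega>' i \<in> torsion \<psi> (u ^ n)"
proof -
  have i: "i \<in> {1..r}"
    using assms s_less_r by auto
  have "0 \<le> w (\<omega>' i)"
    using w_preimage[OF i] w_lam(2)[OF i] assms by simp
  then have "poly (\<psi> (u ^ n)) (\<omega>' i) = 0"
    using lattice_integral_eq_0 act_preimage_in_lattice[OF i] w_act_nonneg by blast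
  then show ?thesis
    by (simp add: torsion_def)
qed

lemma preimage_independent:
  assumes "i \<le> r"
  shows "A_mod_independent \<psi> (u ^ n) {1..i} \<omega>'"
proof -
  have "A_mod_independent \<phi> (u ^ n) {1..r} lam"
    using torsion_smb s_less_r by (simp add: torsion_SMB_def)
  then have indep: "A_mod_independent \<phi> (u ^ n) {1..i} lam"
    by (rule phi.A_mod_independent_subset) (use assms in auto)
  show ?thesis
    unfolding A_mod_independent_def
  proof (intro allI impI)
    fix c assume sum: "(\<Sum>j\<in>{1..i}. poly (\<psi> (c j)) (\<omega>' j)) = 0"
    have "{1..i} \<subseteq> {1..r}"
      using assms by auto
    then have "(\<Sum>j\<in>{1..i}. poly (\<phi> (c j)) (lam j)) = 0"
      using e_combination[of "{1..i}" c] unfolding sum by simp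
    then show "\<forall>j\<in>{1..i}. u ^ n dvd c j"
      using indep unfolding A_mod_independent_def by blast
  qed
qed

text \<open>On \<open>\<psi>[u^n]\<close> the map \<open>e\<close> preserves valuations. It also
  preserves independence, since a relation between images lifts to an integral lattice element,
  which is zero. Competitors thus map to competitors for \<open>lam\<close>.\<close>

lemma torsion_SMB_preimage: "torsion_SMB w \<psi> s (u ^ n) \<omega>'"
  unfolding torsion_SMB_def
proof (intro ballI conjI impI)
  fix i assume i: "i \<in> {1..s}"
  then have ir: "i \<in> {1..r}"
    using s_less_r by auto
  show "\<omega>' i \<in> torsion \<psi> (u ^ n)"
    using i by (rule preimage_torsion)
  show "A_mod_independent \<psi> (u ^ n) {1..i} \<omega>'"
    using ir by (intro preimage_independent) simp
  fix y assume y: "y \<in> torsion \<psi> (u ^ n)"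
    and indep: "A_mod_independent \<psi> (u ^ n) {1..i} (\<omega>'(i := y))"
  let ?x = "\<omega>'(i := y)"
  have "A_mod_independent \<phi> (u ^ n) {1..i} (lam(i := e y))"
    unfolding A_mod_independent_def
  proof (intro allI impI)
    fix c assume sum: "(\<Sum>j\<in>{1..i}. poly (\<phi> (c j)) ((lam(i := e y)) j)) = 0"
    let ?z = "\<Sum>j\<in>{1..i}. poly (\<psi> (c j)) (?x j)"
    have "e ?z = (\<Sum>j\<in>{1..i}. poly (\<phi> (c j)) ((lam(i := e y)) j))"
      unfolding exp.sum e_act using ir e_preimage by (intro sum.cong) auto
    then have "?z \<in> \<Lambda>"
      using sum e_eq_0_iff by simp
    moreover have "0 \<le> w ?z"
    proof (intro w_sum_ge w_act_nonneg)
      fix j assume "j \<in> {1..i}"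
      then have "?x j \<in> torsion \<psi> (u ^ n)"
        using y preimage_torsion i by auto
      then show "0 \<le> w (?x j)"
        by (rule w_torsion) simp
    qed
    ultimately have "?z = 0"
      by (rule lattice_integral_eq_0)
    then show "\<forall>j\<in>{1..i}. u ^ n dvd c j"
      using indep unfolding A_mod_independent_def by blast
  qed
  moreover have "e y \<in> torsion \<phi> (u ^ n)"
    using y by (simp add: torsion_def flip: e_act)
  ultimately have "w (e y) \<le> w (lam i)"
    using torsion_smb ir by (simp add: torsion_SMB_def)
  then show "w y \<le> w (\<omega>' i)"
    using w_preimage[OF ir] w_e_small[OF torsion_small[OF y]] by simp
qed

text \<open>The \<open>s\<close> independent vectors span a set with as many elements as
  \<open>\<psi>[u]\<close>.\<close>

lemma torsion_spanned:
  "torsion \<psi> u = psi.combinations {1..s} (\<lambda>j. poly (\<psi> (u ^ (n - 1))) (\<omega>' j))"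
proof (rule sym, rule card_subset_eq)
  let ?x = "\<lambda>j. poly (\<psi> (u ^ (n - 1))) (\<omega>' j)"
  have x: "?x j \<in> torsion \<psi> u" if "j \<in> {1..s}" for j
    using preimage_torsion[OF that] u_power_Suc psi.torsion_mult by metis
  show "finite (torsion \<psi> u)"
    by (simp add: card_torsion)
  show "psi.combinations {1..s} ?x \<subseteq> torsion \<psi> u"
  proof
    fix z assume "z \<in> psi.combinations {1..s} ?x"
    then obtain c where z: "z = (\<Sum>j\<in>{1..s}. poly (\<psi> (c j)) (?x j))"
      by (auto simp: psi.combinations_def)
    have "poly (\<psi> u) (poly (\<psi> (c j)) (?x j)) = 0" if "j \<in> {1..s}" for j
      using x[OF that] unfolding torsion_def act.scale_left_commute[of u "c j"] by simp
    then have "poly (\<psi> u) z = 0"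
      unfolding z act.scale_sum_right by (intro sum.neutral) blast
    then show "z \<in> torsion \<psi> u"
      by (simp add: torsion_def)
  qed
  have "A_mod_independent \<psi> u {1..s} ?x"
    using preimage_independent[of s] s_less_r n_pos by (simp add: psi.A_mod_independent_power)
  then show "card (psi.combinations {1..s} ?x) = card (torsion \<psi> u)"
    using psi.card_combinations[of "{1..s}" u ?x] x
    by (simp add: card_torsion card_residues mult.commute[of s] flip: power_mult)
qed

text \<open>The \<open>u^(n-1)\<close>-multiple \<open>\<tau>\<close> of the corresponding
  combination of the \<open>\<omega>' j\<close> is \<open>u\<close>-torsion, hence spanned by the
  first \<open>s\<close> vectors. Applying \<open>e\<close> yields a relation among the independent
  \<open>lam'\<close>.\<close>

lemma relation_divisible:
  assumes i: "i \<le> r" and sum: "(\<Sum>j\<in>{s + 1..i}. poly (\<psi> (c j)) (poly (\<psi> (u ^ n)) (\<omega>' j))) = 0"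
    and j: "j \<in> {s + 1..i}"
  shows "u dvd c j"
proof -
  let ?I = "{s + 1..i}"
  define \<tau> where "\<tau> = poly (\<psi> (u ^ (n - 1))) (\<Sum>j\<in>?I. poly (\<psi> (c j)) (\<omega>' j))"
  have "poly (\<psi> u) \<tau> = poly (\<psi> (u ^ n)) (\<Sum>j\<in>?I. poly (\<psi> (c j)) (\<omega>' j))"
    by (simp add: \<tau>_def u_power_Suc)
  also have "\<dots> = (\<Sum>j\<in>?I. poly (\<psi> (c j)) (poly (\<psi> (u ^ n)) (\<omega>' j)))"
    unfolding act.scale_sum_right by (simp add: mult.commute)
  finally have "\<tau> \<in> torsion \<psi> u"
    using sum by (simp add: torsion_def)
  then obtain d where d: "\<tau> = (\<Sum>j\<in>{1..s}. poly (\<psi> (d j)) (poly (\<psi> (u ^ (n - 1))) (\<omega>' j)))"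
    unfolding torsion_spanned psi.combinations_def by blast
  have "e \<tau> = (\<Sum>j\<in>{1..s}. poly (\<phi> (d j)) (lam' j))"
    unfolding d exp.sum e_act lam'_def using e_preimage s_less_r by (intro sum.cong) auto
  moreover have "e \<tau> = (\<Sum>j\<in>?I. poly (\<phi> (c j)) (lam' j))"
  proof -
    have "e \<tau> = poly (\<phi> (u ^ (n - 1))) (\<Sum>j\<in>?I. poly (\<phi> (c j)) (lam j))"
      unfolding \<tau>_def e_act using e_combination[of ?I c] i by simp
    then show ?thesis
      unfolding phi.scale_sum_right lam'_def by (simp add: mult.commute)
  qed
  ultimately have eq: "(\<Sum>j\<in>?I. poly (\<phi> (c j)) (lam' j)) = (\<Sum>j\<in>{1..s}. poly (\<phi> (d j)) (lam' j))"
    by simp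
  \<comment> \<open>The two expansions of \<open>e \<tau>\<close> are subtracted to give one
    relation over \<open>{1..i}\<close>.\<close>
  define f where "f j = (if j \<le> s then - d j else c j)" for j
  have split: "{1..i} = {1..s} \<union> ?I"
    using j by auto
  have "(\<Sum>j\<in>{1..i}. poly (\<phi> (f j)) (lam' j)) =
      (\<Sum>j\<in>{1..s}. poly (\<phi> (f j)) (lam' j)) + (\<Sum>j\<in>?I. poly (\<phi> (f j)) (lam' j))"
    unfolding split by (rule sum.union_disjoint) auto
  also have "\<dots> = - (\<Sum>j\<in>{1..s}. poly (\<phi> (d j)) (lam' j)) + (\<Sum>j\<in>?I. poly (\<phi> (c j)) (lam' j))"
    by (simp add: f_def sum_negf)
  also have "\<dots> = 0"
    using eq by simp
  finally have "\<forall>j\<in>{1..i}. u dvd f j"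
    using lam'_independent[OF i] unfolding A_mod_independent_def by blast
  then have "u dvd f j"
    using j by auto
  then show ?thesis
    using j by (simp add: f_def)
qed

text \<open>The coefficients of a relation are divisible by \<open>u\<close>, and \<open>u\<close>
  can be cancelled because \<open>\<Lambda>\<close> is torsion-free. Repetition makes them divisible
  by every power of \<open>u\<close>.\<close>

lemma lattice_preimage_independent:
  assumes i: "i \<le> r"
  shows "A_independent \<psi> {s + 1..i} (\<lambda>j. poly (\<psi> (u ^ n)) (\<omega>' j))"
  unfolding A_independent_def
proof (intro allI impI ballI)
  let ?I = "{s + 1..i}" and ?\<eta> = "\<lambda>j. poly (\<psi> (u ^ n)) (\<omega>' j)"
  have dvd: "\<forall>j\<in>?I. u ^ k dvd c j" if "(\<Sum>j\<in>?I. poly (\<psi> (c j)) (?\<eta> j)) = 0" for c k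
    using that
  proof (induction k arbitrary: c)
    case (Suc k)
    have "\<forall>j\<in>?I. \<exists>d. c j = u * d"
      using relation_divisible[OF i Suc.prems] by (auto simp: dvd_def)
    then obtain d where d: "\<And>j. j \<in> ?I \<Longrightarrow> c j = u * d j"
      by metis
    have "poly (\<psi> u) (\<Sum>j\<in>?I. poly (\<psi> (d j)) (?\<eta> j)) = (\<Sum>j\<in>?I. poly (\<psi> (c j)) (?\<eta> j))"
      unfolding act.scale_sum_right using d by (intro sum.cong) (auto simp: mult.assoc)
    also have "\<dots> = 0"
      by (rule Suc.prems)
    finally have "poly (\<psi> u) (\<Sum>j\<in>?I. poly (\<psi> (d j)) (?\<eta> j)) = 0" .
    moreover have "(\<Sum>j\<in>?I. poly (\<psi> (d j)) (?\<eta> j)) \<in> \<Lambda>"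
      using i by (intro lattice_sum lattice_act act_preimage_in_lattice) auto
    ultimately have "(\<Sum>j\<in>?I. poly (\<psi> (d j)) (?\<eta> j)) = 0"
      using lattice_torsion_free u_neq_0 by blast
    then show ?case
      using Suc.IH d by simp
  qed simp
  fix c j assume "(\<Sum>j\<in>?I. poly (\<psi> (c j)) (?\<eta> j)) = 0" and j: "j \<in> ?I"
  then have "u ^ Suc (degree (c j)) dvd c j"
    using dvd by blast
  moreover have "degree (c j) < degree (u ^ Suc (degree (c j)))"
    using degree_gt_0_if_prime[OF prime_u] mult_le_mono2[of 1 "degree u" "Suc (degree (c j))"]
    by (subst degree_power_eq) auto
  ultimately show "c j = 0"
    using dvd_imp_degree_le[of _ "c j"] by (metis not_less)
qed

text \<open>A best competitor beating position \<open>i\<close> would, after division by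
  \<open>u^n\<close>, yield a torsion point beating \<open>lam i\<close>. That point must lie in the
  old span modulo \<open>u\<close>, and division by \<open>u\<close> then produces a still better
  competitor.\<close>

lemma lattice_preimage_minimal:
  assumes "i \<in> {s + 1..r}" and "y \<in> \<Lambda>"
    and "A_independent \<psi> {s + 1..i} ((\<lambda>j. poly (\<psi> (u ^ n)) (\<omega>' j))(i := y))"
  shows "w y \<le> w (poly (\<psi> (u ^ n)) (\<omega>' i))"
  using assms
proof (induction i arbitrary: y rule: less_induct)
  case (less i)
  define \<eta> where "\<eta> = (\<lambda>j. poly (\<psi> (u ^ n)) (\<omega>' j))"
  define Y where "Y = {y \<in> \<Lambda>. A_independent \<psi> {s + 1..i} (\<eta>(i := y))}"
  have i: "i \<in> {1..r}" "i \<in> {s + 1..r}" "i \<in> {s + 1..i}"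
    using less.prems(1) by auto
  have "finite {y \<in> Y. ereal B \<le> w y}" for B
    by (rule finite_subset[OF _ finite_lattice_ball[of B]]) (auto simp: Y_def)
  moreover have yY: "y \<in> Y"
    using less.prems unfolding Y_def \<eta>_def by blast
  ultimately obtain x where x: "x \<in> Y" and max: "\<And>y'. y' \<in> Y \<Longrightarrow> w y' \<le> w x"
    using ex_max_w[of Y] by blast
  have x\<Lambda>: "x \<in> \<Lambda>" and indep: "A_independent \<psi> {s + 1..i} (\<eta>(i := x))"
    using x by (auto simp: Y_def)
  have "w x \<le> w (\<eta> i)"
  proof (rule ccontr)
    assume "\<not> w x \<le> w (\<eta> i)"
    then have less_x: "w (\<eta> i) < w x"
      by simp
    obtain z where z: "poly (\<psi> (u ^ n)) z = x"
      using act_surj[of "u ^ n" x] by auto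
    have "\<eta> i \<noteq> 0"
      using less_x by auto
    moreover have "\<eta> i \<in> \<Lambda>"
      unfolding \<eta>_def by (rule act_preimage_in_lattice[OF i(1)])
    ultimately have "w (\<eta> i) < 0"
      using w_lattice_neg by blast
    then have "w (\<omega>' i) < 0"
      using w_act_less_0_iff[of "u ^ n"] by (simp add: \<eta>_def)
    then have wz: "w (\<omega>' i) < w z"
      using w_act_less_iff[of "u ^ n" "\<omega>' i" z] less_x z by (simp add: \<eta>_def)
    then have "w (e z) = w z"
      using small[OF i(1)] by (intro w_e_small) auto
    then have "\<not> w (e z) \<le> w (lam i)"
      using wz w_preimage[OF i(1)] by simp
    moreover have "e z \<in> torsion \<phi> (u ^ n)"
      using x\<Lambda> by (simp add: torsion_def z e_eq_0_iff flip: e_act)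
    ultimately have "poly (\<phi> (u ^ (n - 1))) (e z) \<in> phi.combinations {1..<i} lam'"
      using lam_maximal[OF i(1)] by blast
    moreover have "lam' j \<in> torsion \<phi> u" if "j \<in> {1..<i}" for j
      using that i by (intro lam'_torsion) auto
    ultimately obtain c where c: "c \<in> {1..<i} \<rightarrow>\<^sub>E residues u"
      and comb: "poly (\<phi> (u ^ (n - 1))) (e z) = (\<Sum>j\<in>{1..<i}. poly (\<phi> (c j)) (lam' j))"
      using phi.combinations_residues[of u "{1..<i}" lam'] by auto
    \<comment> \<open>The span relation says exactly that \<open>e\<close> kills this element; its
      \<open>u\<close>-multiple is \<open>x\<close> minus a combination of earlier
      \<open>\<eta> j\<close>.\<close>
    define \<mu> where "\<mu> = poly (\<psi> (u ^ (n - 1))) (z - (\<Sum>j\<in>{1..<i}. poly (\<psi> (c j)) (\<omega>' j)))"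
    have "{1..<i} \<subseteq> {1..r}"
      using i by auto
    then have "e \<mu> = poly (\<phi> (u ^ (n - 1))) (e z) -
        poly (\<phi> (u ^ (n - 1))) (\<Sum>j\<in>{1..<i}. poly (\<phi> (c j)) (lam j))"
      unfolding \<mu>_def e_act exp.diff phi.scale_right_diff_distrib
      using e_combination[of "{1..<i}" c] by simp
    also have "\<dots> = 0"
      unfolding comb phi.scale_sum_right lam'_def by (simp add: mult.commute)
    finally have \<mu>\<Lambda>: "\<mu> \<in> \<Lambda>"
      using e_eq_0_iff by simp
    define d where "d j = (if j = i then 1 else - c j)" for j
    have "poly (\<psi> u) \<mu> = poly (\<psi> (u ^ n)) (z - (\<Sum>j\<in>{1..<i}. poly (\<psi> (c j)) (\<omega>' j)))"
      by (simp add: \<mu>_def u_power_Suc)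
    also have "\<dots> = x - (\<Sum>j\<in>{1..<i}. poly (\<psi> (c j)) (\<eta> j))"
      unfolding act.scale_right_diff_distrib act.scale_sum_right z
      by (simp add: \<eta>_def mult.commute)
    \<comment> \<open>Indices up to \<open>s\<close> drop out because \<open>\<omega>' j\<close> is
      \<open>u^n\<close>-torsion there.\<close>
    also have "(\<Sum>j\<in>{1..<i}. poly (\<psi> (c j)) (\<eta> j)) = (\<Sum>j\<in>{s + 1..<i}. poly (\<psi> (c j)) (\<eta> j))"
    proof (rule sum.mono_neutral_right)
      show "\<forall>j\<in>{1..<i} - {s + 1..<i}. poly (\<psi> (c j)) (\<eta> j) = 0"
      proof
        fix j assume "j \<in> {1..<i} - {s + 1..<i}"
        then have "\<eta> j = 0"
          using preimage_torsion[of j] by (auto simp: \<eta>_def torsion_def)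
        then show "poly (\<psi> (c j)) (\<eta> j) = 0"
          by simp
      qed
    qed auto
    also have "x - (\<Sum>j\<in>{s + 1..<i}. poly (\<psi> (c j)) (\<eta> j)) =
        (\<Sum>j\<in>{s + 1..i}. poly (\<psi> (d j)) ((\<eta>(i := x)) j))"
    proof -
      have I: "{s + 1..i} = insert i {s + 1..<i}"
        using i by auto
      have "(\<Sum>j\<in>{s + 1..<i}. poly (\<psi> (d j)) ((\<eta>(i := x)) j)) = (\<Sum>j\<in>{s + 1..<i}. - poly (\<psi> (c j)) (\<eta> j))"
        by (intro sum.cong) (auto simp: d_def)
      then show ?thesis
        unfolding I by (simp add: d_def sum_negf)
    qed
    finally have act_\<mu>: "poly (\<psi> u) \<mu> = (\<Sum>j\<in>{s + 1..i}. poly (\<psi> (d j)) ((\<eta>(i := x)) j))" .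
    \<comment> \<open>The vector \<open>x\<close> also competes at each earlier position
      \<open>j\<close>, so the induction hypothesis makes it the one of least valuation, as the
      exchange at \<open>i\<close> requires.\<close>
    have le: "w x \<le> w ((\<eta>(i := x)) j)" if j: "j \<in> {s + 1..i}" for j
    proof (cases "j = i")
      case False
      have "A_independent \<psi> {s + 1..j} (\<eta>(j := x))"
        by (rule psi.A_independent_reindex[OF indep, of "id(j := i)"])
          (use j False in \<open>auto simp: inj_on_def\<close>)
      moreover have "j < i" "j \<in> {s + 1..r}"
        using j False i by auto
      ultimately have "w x \<le> w (\<eta> j)"
        using less.IH[of j x] x\<Lambda> unfolding \<eta>_def by blast
      then show ?thesis
        using False by simp
    qed simp
    have d: "d j \<in> residues u" if "j \<in> {s + 1..i}" for j
    proof (cases "j = i")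
      case True
      then show ?thesis
        using degree_gt_0_if_prime[OF prime_u] by (simp add: d_def residues_def)
    next
      case False
      then have "c j \<in> residues u"
        using c that by auto
      then show ?thesis
        using False by (simp add: d_def residues_def)
    qed
    have "A_independent \<psi> {s + 1..i} ((\<eta>(i := x))(i := \<mu>))" "w ((\<eta>(i := x)) i) < w \<mu>"
      by (rule divide_combination[OF u_neq_0 _ i(3) indep _ _ d _ act_\<mu>];
          use x\<Lambda> le in \<open>simp add: d_def\<close>)+
    then have "\<mu> \<in> Y" "w x < w \<mu>"
      using \<mu>\<Lambda> by (auto simp: Y_def)
    then show False
      using max by (meson not_less)
  qed
  then show ?case
    using max[OF yY] by (simp add: \<eta>_def)
qed

lemma lattice_SMB_preimage: "lattice_SMB w \<psi> \<Lambda> s r (\<lambda>i. poly (\<psi> (u ^ n)) (\<omega>' i))"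
  unfolding lattice_SMB_def val_abs_le_iff[OF s_ge_1]
  using act_preimage_in_lattice lattice_preimage_independent lattice_preimage_minimal by auto

end

end

section \<open>Translation of the hypotheses from absolute values to valuations\<close>

theorem theorem4p2:
  fixes \<iota> :: "'k::{field,finite} poly fract \<Rightarrow> 'c::alg_closed_field"
    and w :: "'c \<Rightarrow> ereal"
    and F K \<Lambda> :: "'c set"
    and \<phi> \<psi> :: "'k poly \<Rightarrow> 'c poly"
    and e :: "'c \<Rightarrow> 'c"
    and \<omega>0 lam :: "nat \<Rightarrow> 'c"
    and u :: "'k poly"
    and r r' n :: nat
  assumes "completed_function_field \<iota> w F K"
    and "1 \<le> r'" and "r' < r"
    and "drinfeld_module \<iota> K r \<phi>"
    and "stable_reduction w r r' \<phi>"
    and "tate_uniformization \<iota> w K r r' \<phi> \<psi> \<Lambda> e"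
    and "lattice_SMB w \<psi> \<Lambda> r' r \<omega>0"
    and "irreducible u" and "lead_coeff u = 1"
    and "0 < n"
    and "ereal (deg_abs (u ^ n)) > val_abs w r' (\<omega>0 r) / val_abs w r' (\<omega>0 (r' + 1))"
    and "torsion_SMB w \<phi> r (u ^ n) lam"
  shows "(\<forall>i\<in>{1..r}. \<exists>!z. val_abs w r' z < val_abs w r' (\<omega>0 (r' + 1)) \<and> e z = lam i) \<and>
    (\<forall>\<omega>'. (\<forall>i\<in>{1..r}. val_abs w r' (\<omega>' i) < val_abs w r' (\<omega>0 (r' + 1)) \<and> e (\<omega>' i) = lam i) \<longrightarrow>
       torsion_SMB w \<psi> r' (u ^ n) \<omega>' \<and>
       lattice_SMB w \<psi> \<Lambda> r' r (\<lambda>i. dm_act \<psi> (u ^ n) (\<omega>' i)))"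
proof -
  interpret C: completed_function_field \<iota> w F K
    by (rule assms(1))
  interpret valued_field w
    by unfold_locales (rule C.valuation)
  have hom: "is_field_hom \<iota>"
    by (rule C.embedding)
  have t: "0 \<le> w (\<iota> (to_fract [:0, 1:]))"
  proof (cases "\<iota> (to_fract [:0, 1:]) = 0")
    case False
    then obtain v where "w (\<iota> (to_fract [:0, 1:])) = ereal v"
      by (rule w_realE)
    then show ?thesis
      using C.finite_prime False by (simp add: w_divide zero_ereal_def)
  qed simp
  interpret tate_uniformized \<iota> w K r' \<psi> r \<phi> \<Lambda> e
    by unfold_locales (use assms(6) hom t in \<open>auto simp: tate_uniformization_def\<close>)
  have prime: "prime_elem u"
    using assms(8) by (rule field_poly_irreducible_imp_prime)
  have smb: "\<omega>0 i \<in> \<Lambda>" "w (\<omega>0 i) < 0" if "i \<in> {r' + 1..r}" for i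
  proof -
    have "\<omega>0 i \<in> \<Lambda>" and "A_independent \<psi> {r' + 1..i} \<omega>0"
      using assms(7) that by (auto simp: lattice_SMB_def)
    then show "\<omega>0 i \<in> \<Lambda>" "w (\<omega>0 i) < 0"
      using w_lattice_neg psi.A_independent_nonzero[of "{r' + 1..i}" \<omega>0 i] that by auto
  qed
  have neg: "w (\<omega>0 (r' + 1)) < 0" "w (\<omega>0 r) < 0"
    using smb assms(3) by auto
  have un: "u ^ n \<noteq> 0"
    using prime by auto
  have "ereal (deg_abs (u ^ n) ^ r') * w (\<omega>0 (r' + 1)) < w (\<omega>0 r)"
    using assms(2,11) neg by (intro val_abs_ratio_less)
  \<comment> \<open>The factor \<open>deg_abs (u ^ n) ^ r'\<close> equals
    \<open>q^(r' * degree (u^n))\<close>, by which the action of \<open>u^n\<close> multiplies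
    negative valuations.\<close>
  then have bound: "w (poly (\<psi> (u ^ n)) (\<omega>0 (r' + 1))) < w (\<omega>0 r)"
    unfolding w_act_neg[OF neg(1) un] deg_abs_def
    using un by (simp add: mult.commute[of r'] power_mult del: power_eq_0_iff)
  interpret smb_setting \<iota> w K r' \<psi> r \<phi> \<Lambda> e \<omega>0 lam u n
    by unfold_locales (use assms prime bound in auto)
  show ?thesis
    unfolding val_abs_less_iff[OF assms(2)]
    using ex1_small_preimage torsion_SMB_preimage lattice_SMB_preimage by blast
qed

end
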